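(* Let $0<\varepsilon<\delta\le 1/2$, $\tau>0$, $c\in(0,1]$, and let $t,N,K$ be positive integers with $cK$ an integer (the paper takes $K$ polynomial in $N$). Suppose (h1) $(R,C)$ with $R,C\in[-1,1]^{N\times N}$ is a degree-$t$ $(\varepsilon,\delta)$-SoS-hard game, and (h2) $S_1,\dots,S_f\subseteq[K]$ satisfy $\|u_{K,S_i}-u_{K,S_j}\|_1>\frac{18}{c}(\tau+1)\varepsilon$ for all $i\neq j$, and for each $i$, $(R_{S_i},C_{S_i})$ is an $(\varepsilon,\tau,c)$-enumeration-hard game with respect to $S_i$. For each $i$ let $G_i=(R'_i,C'_i)$ be the $(N+K)\times(N+K)$ game $$R'_i=\begin{pmatrix}R & -2J_{N\times K}\\ \delta J_{K\times N} & R_{S_i}\end{pmatrix},\qquad C'_i=\begin{pmatrix}C & \delta J_{N\times K}\\ -2J_{K\times N} & C_{S_i}\end{pmatrix},$$ where $J_{a\times b}$ is the all-ones $a\times b$ matrix. Then: (1) there is a single degree-$t$ pseudo-distribution which is a pseudo-equilibrium of every $G_i$; (2) for every $0\le\varepsilon'\le(\varepsilon/15)^2$ and every $i\neq j$, no row-player strategy is the row strategy of both an $\varepsilon'$-NE of $G_i$ and an $\varepsilon'$-NE of $G_j$, and likewise no column-player strategy is the column strategy of both an $\varepsilon'$-NE of $G_i$ and an $\varepsilon'$-NE of $G_j$.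
   Context: For a game $(R,C)$ with $R,C\in\mathbb{R}^{m\times m}$, mixed strategies lie in $\Delta_m=\{x\in[0,1]^m:\sum_ix_i=1\}$, $e_i$ is the $i$-th pure strategy, payoffs are $x^\top Ry$, $x^\top Cy$. $(x,y)$ is an $\varepsilon$-NE if $x^\top Ry\ge e_i^\top Ry-\varepsilon$ and $x^\top Cy\ge x^\top Ce_j-\varepsilon$ for all $i,j$; it is an $\varepsilon$-WNE (well-supported) if $x_i>0\Rightarrow e_i^\top Ry\ge\max_ke_k^\top Ry-\varepsilon$ and $y_j>0\Rightarrow x^\top Ce_j\ge\max_kx^\top Ce_k-\varepsilon$. $\mathrm{supp}(v)$ is the set of nonzero coordinates. Degree-$d$ pseudo-distribution on $\mathbb{R}^m$: finitely supported signed measure whose functional $\tilde{\mathbb E}$ has $\tilde{\mathbb E}[1]=1$ and $\tilde{\mathbb E}[q^2]\ge0$ for $\deg q\le d/2$; it satisfies $h\ge0$ if $\tilde{\mathbb E}[p^2h]\ge0$ whenever $\deg(p^2h)\le d$ ($h=0$ means $\pm h\ge0$). A degree-$d$ pseudo-equilibrium of $(R,C)$ is such a pseudo-distribution over $(x,y)$ satisfying $x_i,y_i\ge0$, $\sum x_i=\sum y_i=1$, $x^\top Ry-e_i^\top Ry\ge0$, $x^\top Cy-x^\top Ce_j\ge0$ for all $i,j$. For $S\subseteq[K]$ and $m\le K$, $u_{m,S}\in\mathbb{R}^m$ has $i$-th coordinate $1/|S|$ if $i\in S$ and $0$ otherwise. Degree-$t$ $(\varepsilon,\delta)$-SoS-hard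 game: $(R,C)$ with $R,C\in[-1,1]^{N\times N}$, $\varepsilon,\delta\in[0,1]$, such that (1) there is a degree-$t$ pseudo-equilibrium of $(R,C)$ that also satisfies $x^\top Ry\ge\delta$ and $x^\top Cy\ge\delta$; (2) every $\varepsilon$-WNE $(x,y)$ of $(R,C)$ has $x^\top(R+C)y<2(\delta-\varepsilon)$. $(\varepsilon,\tau,c)$-enumeration-hard game w.r.t. $S\subseteq[K]$ ($\tau>0$, $\varepsilon,c\in[0,1]$, $cK\in\mathbb{Z}$): $(R_S,C_S)$ with $R_S,C_S\in[-1,1]^{K\times K}$ such that (1) for every $y\in\Delta_K$ some $i$ has $e_i^\top R_Sy\ge1/2$, and for every $x\in\Delta_K$ some $j$ has $x^\top C_Se_j\ge1/2$; (2) for every $\varepsilon$-WNE $(x,y)$, with $\tilde x=(x_1,\dots,x_{cK})$, $\tilde y=(y_1,\dots,y_{cK})$: (a) $\mathrm{supp}(\tilde x),\mathrm{supp}(\tilde y)\subseteq S$; (b) $\|\tilde x-c\,u_{cK,S}\|_1\le\tau\varepsilon$ and $\|\tilde y-c\,u_{cK,S}\|_1\le\tau\varepsilon$.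
   Formalization: The formal theorem assumes each S_i ⊆ [cK] rather than only S_i ⊆ [K]; without this, claim (2) fails, since enumeration-hardness sees S_i only through S_i ∩ [cK] and |S_i|, so one game can be hard for two well-separated sets. *)

theory Defs
  imports Complex_Main "HOL-Library.Poly_Mapping" "Jordan_Normal_Form.Matrix"
begin

text \<open>Conventions: coordinates, pure strategies and variables are numbered from 0, so the set
  \<open>[K]\<close> of the mathematics is \<open>{..<K}\<close>.\<close>

section \<open>Bimatrix games\<close>

definition simplex :: "nat \<Rightarrow> real vec set" where
  "simplex m = {x \<in> carrier_vec m. (\<forall>i<m. 0 \<le> x $ i \<and> x $ i \<le> 1) \<and> (\<Sum>i<m. x $ i) = 1}"

definition payoff :: "real vec \<Rightarrow> real mat \<Rightarrow> real vec \<Rightarrow> real" where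
  "payoff x A y = x \<bullet> (A *\<^sub>v y)"

definition unit_game :: "nat \<Rightarrow> real mat \<Rightarrow> real mat \<Rightarrow> bool" where
  "unit_game m R C \<longleftrightarrow> R \<in> carrier_mat m m \<and> C \<in> carrier_mat m m \<and>
     (\<forall>i<m. \<forall>j<m. R $$ (i, j) \<in> {-1..1} \<and> C $$ (i, j) \<in> {-1..1})"

definition eps_NE ::
    "nat \<Rightarrow> real mat \<Rightarrow> real mat \<Rightarrow> real \<Rightarrow> real vec \<Rightarrow> real vec \<Rightarrow> bool" where
  "eps_NE m R C \<epsilon> x y \<longleftrightarrow> x \<in> simplex m \<and> y \<in> simplex m \<and>
     (\<forall>i<m. payoff x R y \<ge> payoff (unit_vec m i) R y - \<epsilon>) \<and>
     (\<forall>j<m. payoff x C y \<ge> payoff x C (unit_vec m j) - \<epsilon>)"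

definition eps_WNE ::
    "nat \<Rightarrow> real mat \<Rightarrow> real mat \<Rightarrow> real \<Rightarrow> real vec \<Rightarrow> real vec \<Rightarrow> bool" where
  "eps_WNE m R C \<epsilon> x y \<longleftrightarrow> x \<in> simplex m \<and> y \<in> simplex m \<and>
     (\<forall>i<m. x $ i > 0 \<longrightarrow>
        payoff (unit_vec m i) R y \<ge> Max ((\<lambda>k. payoff (unit_vec m k) R y) ` {..<m}) - \<epsilon>) \<and>
     (\<forall>j<m. y $ j > 0 \<longrightarrow>
        payoff x C (unit_vec m j) \<ge> Max ((\<lambda>k. payoff x C (unit_vec m k)) ` {..<m}) - \<epsilon>)"

definition supp :: "real vec \<Rightarrow> nat set" where
  "supp v = {i. i < dim_vec v \<and> v $ i \<noteq> 0}"

definition l1_norm :: "real vec \<Rightarrow> real" where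
  "l1_norm v = (\<Sum>i<dim_vec v. \<bar>v $ i\<bar>)"

definition unif_vec :: "nat \<Rightarrow> nat set \<Rightarrow> real vec" where
  "unif_vec m S = vec m (\<lambda>i. if i \<in> S then 1 / real (card S) else 0)"

section \<open>Real multivariate polynomials\<close>

text \<open>A monomial is a finitely supported exponent function, a polynomial a finitely supported
  function from monomials to coefficients; the ring structure (convolution product) is the
  one of \<open>Poly_Mapping\<close>.\<close>

type_synonym mpoly = "(nat \<Rightarrow>\<^sub>0 nat) \<Rightarrow>\<^sub>0 real"

definition polys :: "nat \<Rightarrow> mpoly set" where
  "polys m = {p. \<forall>a\<in>Poly_Mapping.keys p. Poly_Mapping.keys a \<subseteq> {..<m}}"

text \<open>Total degree; the zero polynomial gets degree 0, which is harmless below because every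
  pseudo-expectation vanishes on it.\<close>

definition total_degree :: "mpoly \<Rightarrow> nat" where
  "total_degree p = Max (insert 0 ((\<lambda>a. \<Sum>i\<in>Poly_Mapping.keys a. Poly_Mapping.lookup a i) ` Poly_Mapping.keys p))"

definition eval_poly :: "mpoly \<Rightarrow> real vec \<Rightarrow> real" where
  "eval_poly p v = (\<Sum>a\<in>Poly_Mapping.keys p. Poly_Mapping.lookup p a * (\<Prod>i\<in>Poly_Mapping.keys a. v $ i ^ Poly_Mapping.lookup a i))"

definition PConst :: "real \<Rightarrow> mpoly" where
  "PConst c = Poly_Mapping.single 0 c"

definition PVar :: "nat \<Rightarrow> mpoly" where
  "PVar i = Poly_Mapping.single (Poly_Mapping.single i 1) 1"

section \<open>Pseudo-distributions\<close>

text \<open>A finitely supported signed measure on \<open>\<real>\<^sup>m\<close> is given by its weights, i.e. by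
  a finitely supported function on vectors whose support lies in \<^term>\<open>carrier_vec m\<close>.\<close>

definition pseudo_expectation :: "(real vec \<Rightarrow>\<^sub>0 real) \<Rightarrow> mpoly \<Rightarrow> real" where
  "pseudo_expectation \<mu> p = (\<Sum>v\<in>Poly_Mapping.keys \<mu>. Poly_Mapping.lookup \<mu> v * eval_poly p v)"

definition pseudo_distribution :: "nat \<Rightarrow> nat \<Rightarrow> (real vec \<Rightarrow>\<^sub>0 real) \<Rightarrow> bool" where
  "pseudo_distribution d m \<mu> \<longleftrightarrow> Poly_Mapping.keys \<mu> \<subseteq> carrier_vec m \<and>
     pseudo_expectation \<mu> 1 = 1 \<and>
     (\<forall>q\<in>polys m. real (total_degree q) \<le> real d / 2 \<longrightarrow> pseudo_expectation \<mu> (q ^ 2) \<ge> 0)"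

definition satisfies_nonneg :: "nat \<Rightarrow> nat \<Rightarrow> (real vec \<Rightarrow>\<^sub>0 real) \<Rightarrow> mpoly \<Rightarrow> bool" where
  "satisfies_nonneg d m \<mu> h \<longleftrightarrow>
     (\<forall>p\<in>polys m. total_degree (p ^ 2 * h) \<le> d \<longrightarrow> pseudo_expectation \<mu> (p ^ 2 * h) \<ge> 0)"

definition satisfies_zero :: "nat \<Rightarrow> nat \<Rightarrow> (real vec \<Rightarrow>\<^sub>0 real) \<Rightarrow> mpoly \<Rightarrow> bool" where
  "satisfies_zero d m \<mu> h \<longleftrightarrow> satisfies_nonneg d m \<mu> h \<and> satisfies_nonneg d m \<mu> (- h)"

text \<open>A pseudo-distribution over strategy pairs \<open>(x, y)\<close> with \<open>x, y \<in> \<real>\<^sup>m\<close> lives on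
  \<open>\<real>\<^sup>2\<^sup>m\<close>: variable \<open>i\<close> stands for \<open>x\<^sub>i\<close> and variable \<open>m + j\<close> for \<open>y\<^sub>j\<close>.
  The next three polynomials are \<open>x\<^sup>T A y\<close>, \<open>e\<^sub>i\<^sup>T A y\<close> and \<open>x\<^sup>T A e\<^sub>j\<close>.\<close>

definition PX :: "nat \<Rightarrow> nat \<Rightarrow> mpoly" where
  "PX m i = PVar i"

definition PY :: "nat \<Rightarrow> nat \<Rightarrow> mpoly" where
  "PY m j = PVar (m + j)"

definition payoff_poly :: "nat \<Rightarrow> real mat \<Rightarrow> mpoly" where
  "payoff_poly m A = (\<Sum>i<m. \<Sum>j<m. PConst (A $$ (i, j)) * PX m i * PY m j)"

definition row_payoff_poly :: "nat \<Rightarrow> real mat \<Rightarrow> nat \<Rightarrow> mpoly" where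
  "row_payoff_poly m A i = (\<Sum>j<m. PConst (A $$ (i, j)) * PY m j)"

definition col_payoff_poly :: "nat \<Rightarrow> real mat \<Rightarrow> nat \<Rightarrow> mpoly" where
  "col_payoff_poly m A j = (\<Sum>i<m. PConst (A $$ (i, j)) * PX m i)"

definition pseudo_equilibrium ::
    "nat \<Rightarrow> nat \<Rightarrow> real mat \<Rightarrow> real mat \<Rightarrow> (real vec \<Rightarrow>\<^sub>0 real) \<Rightarrow> bool" where
  "pseudo_equilibrium d m R C \<mu> \<longleftrightarrow> pseudo_distribution d (2 * m) \<mu> \<and>
     (\<forall>i<m. satisfies_nonneg d (2 * m) \<mu> (PX m i)) \<and>
     (\<forall>i<m. satisfies_nonneg d (2 * m) \<mu> (PY m i)) \<and>
     satisfies_zero d (2 * m) \<mu> ((\<Sum>i<m. PX m i) - 1) \<and>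
     satisfies_zero d (2 * m) \<mu> ((\<Sum>i<m. PY m i) - 1) \<and>
     (\<forall>i<m. satisfies_nonneg d (2 * m) \<mu> (payoff_poly m R - row_payoff_poly m R i)) \<and>
     (\<forall>j<m. satisfies_nonneg d (2 * m) \<mu> (payoff_poly m C - col_payoff_poly m C j))"

section \<open>Hard games\<close>

definition sos_hard :: "nat \<Rightarrow> nat \<Rightarrow> real \<Rightarrow> real \<Rightarrow> real mat \<Rightarrow> real mat \<Rightarrow> bool" where
  "sos_hard t N \<epsilon> \<delta> R C \<longleftrightarrow>
     unit_game N R C \<and> \<epsilon> \<in> {0..1} \<and> \<delta> \<in> {0..1} \<and>
     (\<exists>\<mu>. pseudo_equilibrium t N R C \<mu> \<and>
        satisfies_nonneg t (2 * N) \<mu> (payoff_poly N R - PConst \<delta>) \<and>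
        satisfies_nonneg t (2 * N) \<mu> (payoff_poly N C - PConst \<delta>)) \<and>
     (\<forall>x y. eps_WNE N R C \<epsilon> x y \<longrightarrow> payoff x (R + C) y < 2 * (\<delta> - \<epsilon>))"

text \<open>Conditions on equilibria only concern the first \<open>n = c K\<close> coordinates and hence only
  \<open>S \<inter> {..<n}\<close> and \<open>card S\<close>: for \<open>S \<subseteq> {..<K}\<close> not contained in \<open>{..<n}\<close>, one and the same
  game can be enumeration-hard with respect to several sets at once.\<close>

definition enumeration_hard ::
    "nat \<Rightarrow> real \<Rightarrow> real \<Rightarrow> real \<Rightarrow> nat set \<Rightarrow> real mat \<Rightarrow> real mat \<Rightarrow> bool" where
  "enumeration_hard K \<epsilon> \<tau> c S R C \<longleftrightarrow>
     S \<subseteq> {..<K} \<and> \<tau> > 0 \<and> \<epsilon> \<in> {0..1} \<and> c \<in> {0..1} \<and> c * real K \<in> \<int> \<and>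
     unit_game K R C \<and>
     (\<forall>y\<in>simplex K. \<exists>i<K. payoff (unit_vec K i) R y \<ge> 1 / 2) \<and>
     (\<forall>x\<in>simplex K. \<exists>j<K. payoff x C (unit_vec K j) \<ge> 1 / 2) \<and>
     (\<forall>x y. eps_WNE K R C \<epsilon> x y \<longrightarrow>
        (let n = nat \<lfloor>c * real K\<rfloor>; x' = vec_first x n; y' = vec_first y n in
           supp x' \<subseteq> S \<and> supp y' \<subseteq> S \<and>
           l1_norm (x' - c \<cdot>\<^sub>v unif_vec n S) \<le> \<tau> * \<epsilon> \<and>
           l1_norm (y' - c \<cdot>\<^sub>v unif_vec n S) \<le> \<tau> * \<epsilon>))"

section \<open>The combined game\<close>

definition ones_mat :: "nat \<Rightarrow> nat \<Rightarrow> real mat" where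
  "ones_mat a b = mat a b (\<lambda>_. 1)"

definition combined_row :: "nat \<Rightarrow> nat \<Rightarrow> real \<Rightarrow> real mat \<Rightarrow> real mat \<Rightarrow> real mat" where
  "combined_row N K \<delta> R R\<^sub>S =
     four_block_mat R ((-2) \<cdot>\<^sub>m ones_mat N K) (\<delta> \<cdot>\<^sub>m ones_mat K N) R\<^sub>S"

definition combined_col :: "nat \<Rightarrow> nat \<Rightarrow> real \<Rightarrow> real mat \<Rightarrow> real mat \<Rightarrow> real mat" where
  "combined_col N K \<delta> C C\<^sub>S =
     four_block_mat C (\<delta> \<cdot>\<^sub>m ones_mat N K) ((-2) \<cdot>\<^sub>m ones_mat K N) C\<^sub>S"

end

theory Submission
  imports Defs
begin

text \<open>The second block of every combined game guarantees more than a row or column of the first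
  block can earn against an opponent in the second one. So a pseudo-equilibrium of value at least \<open>\<delta>\<close>
  of the first block, padded by zeros, stays a pseudo-equilibrium and does not see the second block.
  A genuine approximate equilibrium is close to a well-supported one; if that one touched the first
  block, then, conditioned on it, it would be a well-supported equilibrium of \<open>(R, C)\<close> of value
  \<open>2 (\<delta> - \<epsilon>)\<close>, which is excluded. It therefore lives on the second block, where it
  reveals the set \<open>S\<^sub>i\<close>.\<close>

section \<open>Substitution into polynomials and total degree\<close>

text \<open>Two obstacles shape the proof. The first is degree bookkeeping. A multiplier
  \<open>p\<close> may be used on \<open>h\<close> only if
  \<open>total_degree (p ^ 2 * h) \<le> d\<close>. For a deviation into the second block, the padded
  constraint is q - \<delta> L \<ge> 0 with q a payoff polynomial and L a sum of variables, while
  only q \<ge> \<delta> and L = 1 are given. Combining these needs exact degrees of products, hence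
  the additivity of total degree. Padding itself is a substitution of degree at most one, which
  cannot raise degrees.

  The second is the loss of slack. Conditioning on the first block divides by the opponent's mass
  there, which turns out to be at least 4/7, so a slack of \<epsilon>/2 stays within \<epsilon>.
  This is why approximate equilibria are rounded to slack \<epsilon>/2. The square in
  (\<epsilon>/15)^2 is the price of that rounding: dropping the strategies k below the best response
  moves a mass of order \<epsilon>'/k, and k itself must be of order \<epsilon>.

  The column player needs no separate argument: transposing the column matrix turns it into a row
  matrix of the same block shape.\<close>

definition monom_eval :: "(nat \<Rightarrow> 'b::comm_ring_1) \<Rightarrow> (nat \<Rightarrow>\<^sub>0 nat) \<Rightarrow> 'b" where
  "monom_eval \<sigma> a = (\<Prod>i\<in>Poly_Mapping.keys a. \<sigma> i ^ Poly_Mapping.lookup a i)"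

text \<open>The coefficient map \<open>h\<close> covers two uses at once: the identity gives
  evaluation at a real point, \<open>PConst\<close> gives substitution of polynomials for
  variables.\<close>

definition poly_subst :: "(real \<Rightarrow> 'b::comm_ring_1) \<Rightarrow> (nat \<Rightarrow> 'b) \<Rightarrow> mpoly \<Rightarrow> 'b" where
  "poly_subst h \<sigma> p =
     (\<Sum>a\<in>Poly_Mapping.keys p. h (Poly_Mapping.lookup p a) * monom_eval \<sigma> a)"

lemma eval_poly_eq_subst: "eval_poly p v = poly_subst (\<lambda>x. x) (($) v) p"
  by (simp add: eval_poly_def poly_subst_def monom_eval_def)

lemma monom_eval_superset:
  assumes "finite B" "Poly_Mapping.keys a \<subseteq> B"
  shows "monom_eval \<sigma> a = (\<Prod>i\<in>B. \<sigma> i ^ Poly_Mapping.lookup a i)"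
  unfolding monom_eval_def
  by (rule prod.mono_neutral_left) (use assms in \<open>auto simp: in_keys_iff\<close>)

lemma monom_eval_add: "monom_eval \<sigma> (a + b) = monom_eval \<sigma> a * monom_eval \<sigma> b"
proof -
  let ?B = "Poly_Mapping.keys a \<union> Poly_Mapping.keys b"
  have "monom_eval \<sigma> c = (\<Prod>i\<in>?B. \<sigma> i ^ Poly_Mapping.lookup c i)" if "c \<in> {a, b, a + b}" for c
    by (rule monom_eval_superset) (use that keys_add[of a b] in auto)
  then show ?thesis
    by (simp add: lookup_add power_add prod.distrib)
qed

lemma sum_single_lookup:
  fixes p :: "'a \<Rightarrow>\<^sub>0 'b::comm_monoid_add"
  shows "p = (\<Sum>a\<in>Poly_Mapping.keys p. Poly_Mapping.single a (Poly_Mapping.lookup p a))"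
  by (rule poly_mapping_eqI)
    (simp add: lookup_sum lookup_single when_def in_keys_iff)

locale coefficient_hom =
  fixes h :: "real \<Rightarrow> 'b::comm_ring_1"
  assumes hom_add: "h (x + y) = h x + h y"
    and hom_mult: "h (x * y) = h x * h y"
    and hom_one: "h 1 = 1"
begin

lemma hom_zero: "h 0 = 0"
  using hom_add[of 0 0] by simp

lemma poly_subst_superset:
  assumes "finite B" "Poly_Mapping.keys p \<subseteq> B"
  shows "poly_subst h \<sigma> p = (\<Sum>a\<in>B. h (Poly_Mapping.lookup p a) * monom_eval \<sigma> a)"
  unfolding poly_subst_def
  by (rule sum.mono_neutral_left) (use assms in \<open>auto simp: in_keys_iff hom_zero\<close>)

lemma poly_subst_add: "poly_subst h \<sigma> (p + q) = poly_subst h \<sigma> p + poly_subst h \<sigma> q"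
proof -
  let ?B = "Poly_Mapping.keys p \<union> Poly_Mapping.keys q"
  have "poly_subst h \<sigma> r = (\<Sum>a\<in>?B. h (Poly_Mapping.lookup r a) * monom_eval \<sigma> a)"
    if "r \<in> {p, q, p + q}" for r
    by (rule poly_subst_superset) (use that keys_add[of p q] in auto)
  then show ?thesis
    by (simp add: lookup_add hom_add distrib_right sum.distrib)
qed

lemma poly_subst_zero: "poly_subst h \<sigma> 0 = 0"
  by (simp add: poly_subst_def)

lemma poly_subst_sum: "poly_subst h \<sigma> (sum g A) = (\<Sum>x\<in>A. poly_subst h \<sigma> (g x))"
  by (induction A rule: infinite_finite_induct) (simp_all add: poly_subst_zero poly_subst_add)

lemma poly_subst_single: "poly_subst h \<sigma> (Poly_Mapping.single a c) = h c * monom_eval \<sigma> a"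
  by (simp add: poly_subst_def hom_zero)

lemma poly_subst_PConst: "poly_subst h \<sigma> (PConst c) = h c"
  by (simp add: PConst_def poly_subst_single monom_eval_def)

lemma poly_subst_one: "poly_subst h \<sigma> 1 = 1"
  using poly_subst_PConst[of \<sigma> 1] by (simp add: PConst_def hom_one)

lemma poly_subst_PVar: "poly_subst h \<sigma> (PVar i) = \<sigma> i"
  by (simp add: PVar_def poly_subst_single monom_eval_def hom_one)

lemma poly_subst_mult: "poly_subst h \<sigma> (p * q) = poly_subst h \<sigma> p * poly_subst h \<sigma> q"
proof -
  let ?P = "Poly_Mapping.keys p" and ?Q = "Poly_Mapping.keys q"
  have "p * q = (\<Sum>a\<in>?P. \<Sum>b\<in>?Q. Poly_Mapping.single (a + b)
      (Poly_Mapping.lookup p a * Poly_Mapping.lookup q b))"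
    by (subst (1) sum_single_lookup[of p], subst (1) sum_single_lookup[of q])
      (simp add: sum_product mult_single)
  then have "poly_subst h \<sigma> (p * q) = (\<Sum>a\<in>?P. \<Sum>b\<in>?Q.
      h (Poly_Mapping.lookup p a) * monom_eval \<sigma> a * (h (Poly_Mapping.lookup q b) * monom_eval \<sigma> b))"
    by (simp add: poly_subst_sum poly_subst_single monom_eval_add hom_mult mult_ac)
  then show ?thesis
    by (simp add: poly_subst_def[of _ _ p] poly_subst_def[of _ _ q] sum_product)
qed

lemma poly_subst_power: "poly_subst h \<sigma> (p ^ k) = poly_subst h \<sigma> p ^ k"
  by (induction k) (simp_all add: poly_subst_one poly_subst_mult)

lemma poly_subst_uminus: "poly_subst h \<sigma> (- p) = - poly_subst h \<sigma> p"
  using poly_subst_add[of \<sigma> p "- p"] by (simp add: poly_subst_zero eq_neg_iff_add_eq_0 add.commute)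

lemma poly_subst_diff: "poly_subst h \<sigma> (p - q) = poly_subst h \<sigma> p - poly_subst h \<sigma> q"
  using poly_subst_add[of \<sigma> p "- q"] by (simp add: poly_subst_uminus)

lemma poly_subst_prod: "poly_subst h \<sigma> (prod g A) = (\<Prod>x\<in>A. poly_subst h \<sigma> (g x))"
  by (induction A rule: infinite_finite_induct) (simp_all add: poly_subst_one poly_subst_mult)

end

interpretation eval: coefficient_hom "\<lambda>x::real. x"
  by unfold_locales auto

interpretation subst: coefficient_hom PConst
  by unfold_locales (auto simp: PConst_def single_add mult_single)

lemma poly_subst_cong:
  assumes "p \<in> polys m" "\<And>i. i < m \<Longrightarrow> \<sigma> i = \<sigma>' i"
  shows "poly_subst h \<sigma> p = poly_subst h \<sigma>' p"
  unfolding poly_subst_def monom_eval_def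
  by (intro sum.cong prod.cong arg_cong2[where f = "(*)"] refl)
    (use assms in \<open>auto simp: polys_def subset_iff\<close>)

lemma eval_poly_subst:
  "eval_poly (poly_subst PConst \<sigma> p) v = poly_subst (\<lambda>x. x) (\<lambda>i. eval_poly (\<sigma> i) v) p"
  by (simp add: eval_poly_eq_subst poly_subst_def[of PConst] poly_subst_def[of _ _ p]
      monom_eval_def eval.poly_subst_sum eval.poly_subst_mult eval.poly_subst_PConst
      eval.poly_subst_prod eval.poly_subst_power)

section \<open>Total degree and its additivity on products\<close>

definition monom_degree :: "(nat \<Rightarrow>\<^sub>0 nat) \<Rightarrow> nat" where
  "monom_degree a = (\<Sum>i\<in>Poly_Mapping.keys a. Poly_Mapping.lookup a i)"

lemma monom_degree_add: "monom_degree (a + b) = monom_degree a + monom_degree b"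
proof -
  let ?B = "Poly_Mapping.keys a \<union> Poly_Mapping.keys b"
  have "monom_degree c = (\<Sum>i\<in>?B. Poly_Mapping.lookup c i)" if "c \<in> {a, b, a + b}" for c
    unfolding monom_degree_def
    by (rule sum.mono_neutral_left) (use that keys_add[of a b] in \<open>auto simp: in_keys_iff\<close>)
  then show ?thesis
    by (simp add: lookup_add sum.distrib)
qed

lemma total_degree_le_iff:
  "total_degree p \<le> d \<longleftrightarrow> (\<forall>a\<in>Poly_Mapping.keys p. monom_degree a \<le> d)"
  by (simp add: total_degree_def monom_degree_def)

lemma monom_degree_le_total_degree:
  "a \<in> Poly_Mapping.keys p \<Longrightarrow> monom_degree a \<le> total_degree p"
  using total_degree_le_iff by blast

lemma total_degree_attained:
  assumes "p \<noteq> 0"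
  obtains a where "a \<in> Poly_Mapping.keys p" "monom_degree a = total_degree p"
proof -
  let ?D = "monom_degree ` Poly_Mapping.keys p"
  have "?D \<noteq> {}" using assms by simp
  then have "Max (insert 0 ?D) = Max ?D" by simp
  moreover have "Max ?D \<in> ?D" using \<open>?D \<noteq> {}\<close> by simp
  ultimately show ?thesis using that by (auto simp: total_degree_def monom_degree_def)
qed

lemma total_degree_add_le:
  "total_degree p \<le> d \<Longrightarrow> total_degree q \<le> d \<Longrightarrow> total_degree (p + q) \<le> d"
  using keys_add[of p q] by (auto simp: total_degree_le_iff)

lemma total_degree_sum_le:
  "(\<And>x. x \<in> A \<Longrightarrow> total_degree (g x) \<le> d) \<Longrightarrow> total_degree (sum g A) \<le> d"
proof (induction A rule: infinite_finite_induct)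
  case (insert x A)
  then show ?case by (simp add: total_degree_add_le)
qed (simp_all add: total_degree_def)

lemma total_degree_PConst: "total_degree (PConst c) = 0"
  by (simp add: total_degree_def PConst_def)

lemma total_degree_PVar: "total_degree (PVar i) = 1"
  by (simp add: total_degree_def PVar_def)

lemma total_degree_mult_le: "total_degree (p * q) \<le> total_degree p + total_degree q"
  unfolding total_degree_le_iff
proof
  fix k assume "k \<in> Poly_Mapping.keys (p * q)"
  then obtain a b where "k = a + b" "a \<in> Poly_Mapping.keys p" "b \<in> Poly_Mapping.keys q"
    using keys_mult[of p q] by auto
  then show "monom_degree k \<le> total_degree p + total_degree q"
    by (simp add: monom_degree_add add_mono monom_degree_le_total_degree)
qed

lemma total_degree_one: "total_degree 1 = 0"
  using total_degree_PConst[of 1] by (simp add: PConst_def)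

lemma total_degree_power_le: "total_degree p \<le> 1 \<Longrightarrow> total_degree (p ^ k) \<le> k"
proof (induction k)
  case (Suc k)
  then show ?case using total_degree_mult_le[of p "p ^ k"] by simp
qed (simp add: total_degree_one)

lemma total_degree_prod_le:
  "(\<And>x. x \<in> A \<Longrightarrow> total_degree (g x) \<le> d x) \<Longrightarrow> total_degree (prod g A) \<le> sum d A"
proof (induction A rule: infinite_finite_induct)
  case (insert x A)
  then show ?case using total_degree_mult_le[of "g x" "prod g A"]
    by (simp add: add_mono order_trans)
qed (simp_all add: total_degree_one)

text \<open>Degrees may drop, for instance when variables are replaced by 0, but never rise. This is
  the direction needed: a multiplier admissible after padding stays admissible when pulled
  back.\<close>

lemma total_degree_subst_le:
  assumes "\<And>i. total_degree (\<sigma> i) \<le> 1"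
  shows "total_degree (poly_subst PConst \<sigma> p) \<le> total_degree p"
  unfolding poly_subst_def
proof (rule total_degree_sum_le)
  fix a assume a: "a \<in> Poly_Mapping.keys p"
  have "total_degree (monom_eval \<sigma> a) \<le> monom_degree a"
    unfolding monom_eval_def monom_degree_def
    by (intro total_degree_prod_le total_degree_power_le assms)
  then show "total_degree (PConst (Poly_Mapping.lookup p a) * monom_eval \<sigma> a) \<le> total_degree p"
    using total_degree_mult_le[of "PConst (Poly_Mapping.lookup p a)" "monom_eval \<sigma> a"]
      monom_degree_le_total_degree[OF a]
    by (simp add: total_degree_PConst)
qed

definition homogeneous_part :: "nat \<Rightarrow> mpoly \<Rightarrow> mpoly" where
  "homogeneous_part d p = (\<Sum>a\<in>{a \<in> Poly_Mapping.keys p. monom_degree a = d}.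
     Poly_Mapping.single a (Poly_Mapping.lookup p a))"

lemma lookup_homogeneous_part:
  "Poly_Mapping.lookup (homogeneous_part d p) a =
     (if monom_degree a = d then Poly_Mapping.lookup p a else 0)"
  by (auto simp: homogeneous_part_def lookup_sum lookup_single when_def in_keys_iff)

text \<open>A product of two monomials of top degree may be cancelled by other such products, so the
  leading forms \<open>p1\<close> and \<open>q1\<close> are multiplied as a whole. Their product is
  nonzero because the polynomial ring has no zero divisors, and everything else in
  \<open>p * q\<close> has smaller degree.\<close>

lemma total_degree_mult:
  assumes "p \<noteq> 0" "q \<noteq> 0"
  shows "total_degree (p * q) = total_degree p + total_degree q"
proof (rule antisym[OF total_degree_mult_le])
  let ?m = "total_degree p" and ?n = "total_degree q"
  define p1 q1 where "p1 = homogeneous_part ?m p" and "q1 = homogeneous_part ?n q"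
  have key: "Poly_Mapping.lookup r k = 0" if "r = u * v" "monom_degree k = ?m + ?n"
    "\<And>a b. a \<in> Poly_Mapping.keys u \<Longrightarrow> b \<in> Poly_Mapping.keys v \<Longrightarrow>
       monom_degree a + monom_degree b < ?m + ?n" for r u v k
  proof (rule ccontr)
    assume "Poly_Mapping.lookup r k \<noteq> 0"
    then have "k \<in> Poly_Mapping.keys (u * v)" using that(1) by (simp add: in_keys_iff)
    then obtain a b where "k = a + b" "a \<in> Poly_Mapping.keys u" "b \<in> Poly_Mapping.keys v"
      using keys_mult[of u v] by auto
    with that(2,3) show False by (force simp: monom_degree_add)
  qed
  have top: "monom_degree a = d \<and> a \<in> Poly_Mapping.keys r"
    if "a \<in> Poly_Mapping.keys (homogeneous_part d r)" for a d r
    using that by (auto simp: in_keys_iff lookup_homogeneous_part split: if_splits)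
  have low: "monom_degree a < total_degree r"
    if "a \<in> Poly_Mapping.keys (r - homogeneous_part (total_degree r) r)" for a r
    using that monom_degree_le_total_degree[of a r]
    by (auto simp: in_keys_iff lookup_minus lookup_homogeneous_part split: if_splits)
  have nz: "homogeneous_part (total_degree r) r \<noteq> 0" if "r \<noteq> 0" for r
    by (rule total_degree_attained[OF that])
      (metis in_keys_iff lookup_homogeneous_part lookup_zero)
  have "p1 * q1 \<noteq> 0" using nz assms by (simp add: p1_def q1_def)
  then obtain k where k: "k \<in> Poly_Mapping.keys (p1 * q1)"
    by (meson ex_in_conv keys_eq_empty)
  then obtain a b where "k = a + b" "a \<in> Poly_Mapping.keys p1" "b \<in> Poly_Mapping.keys q1"
    using keys_mult[of p1 q1] by auto
  then have dk: "monom_degree k = ?m + ?n"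
    using top unfolding p1_def q1_def by (simp add: monom_degree_add)
  \<comment> \<open>The monomials of \<open>p - p1\<close> and of \<open>q - q1\<close> have degree
    strictly below the top, so neither remainder term can reach the monomial
    \<open>k\<close>.\<close>
  have "p * q = p1 * q1 + ((p - p1) * q + p1 * (q - q1))"
    by (simp add: algebra_simps)
  moreover have "Poly_Mapping.lookup ((p - p1) * q) k = 0"
    by (rule key[OF refl dk], unfold p1_def)
      (meson add_less_le_mono low monom_degree_le_total_degree)
  moreover have "Poly_Mapping.lookup (p1 * (q - q1)) k = 0"
    by (rule key[OF refl dk], unfold p1_def q1_def)
      (metis add_le_less_mono low order_refl top)
  ultimately have "k \<in> Poly_Mapping.keys (p * q)"
    using k by (simp add: in_keys_iff lookup_add)
  then show "?m + ?n \<le> total_degree (p * q)"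
    using monom_degree_le_total_degree dk by metis
qed

section \<open>Closure of the polynomials in finitely many variables under ring operations\<close>

lemma polys_zero: "0 \<in> polys m"
  by (simp add: polys_def)

lemma polys_PConst: "PConst c \<in> polys m"
  by (simp add: polys_def PConst_def)

lemma polys_one: "1 \<in> polys m"
  using polys_PConst[of 1] by (simp add: PConst_def)

lemma polys_PVar: "i < m \<Longrightarrow> PVar i \<in> polys m"
  by (simp add: polys_def PVar_def)

lemma polys_add: "p \<in> polys m \<Longrightarrow> q \<in> polys m \<Longrightarrow> p + q \<in> polys m"
  using keys_add[of p q] by (auto simp: polys_def)

lemma polys_uminus: "p \<in> polys m \<Longrightarrow> - p \<in> polys m"
  by (simp add: polys_def)

lemma polys_diff: "p \<in> polys m \<Longrightarrow> q \<in> polys m \<Longrightarrow> p - q \<in> polys m"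
  using polys_add[of p m "- q"] polys_uminus[of q m] by simp

lemma polys_mult:
  assumes "p \<in> polys m" "q \<in> polys m"
  shows "p * q \<in> polys m"
  unfolding polys_def
proof (clarify)
  fix k i assume k: "k \<in> Poly_Mapping.keys (p * q)" and i: "i \<in> Poly_Mapping.keys k"
  obtain a b where "k = a + b" "a \<in> Poly_Mapping.keys p" "b \<in> Poly_Mapping.keys q"
    using k keys_mult[of p q] by auto
  then have "Poly_Mapping.keys a \<subseteq> {..<m}" "Poly_Mapping.keys b \<subseteq> {..<m}" "i \<in> Poly_Mapping.keys a \<union> Poly_Mapping.keys b"
    using assms i keys_add[of a b] by (auto simp: polys_def)
  then show "i < m" by auto
qed

lemma polys_sum: "(\<And>x. x \<in> A \<Longrightarrow> g x \<in> polys m) \<Longrightarrow> sum g A \<in> polys m"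
  by (induction A rule: infinite_finite_induct) (auto intro: polys_add polys_zero)

lemma polys_power: "p \<in> polys m \<Longrightarrow> p ^ k \<in> polys m"
  by (induction k) (auto intro: polys_mult polys_one)

lemma polys_prod: "(\<And>x. x \<in> A \<Longrightarrow> g x \<in> polys m) \<Longrightarrow> prod g A \<in> polys m"
  by (induction A rule: infinite_finite_induct) (auto intro: polys_mult polys_one)

lemmas polys_intros = polys_zero polys_one polys_PConst polys_PVar polys_add polys_uminus
  polys_diff polys_mult polys_sum polys_power polys_prod

lemma polys_subst: "(\<And>i. \<sigma> i \<in> polys m) \<Longrightarrow> poly_subst PConst \<sigma> p \<in> polys m"
  unfolding poly_subst_def monom_eval_def by (intro polys_intros)

section \<open>Transporting pseudo-distributions\<close>

lemma pseudo_expectation_superset: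
  assumes "finite B" "Poly_Mapping.keys \<mu> \<subseteq> B"
  shows "pseudo_expectation \<mu> p = (\<Sum>v\<in>B. Poly_Mapping.lookup \<mu> v * eval_poly p v)"
  unfolding pseudo_expectation_def
  by (rule sum.mono_neutral_left) (use assms in \<open>auto simp: in_keys_iff\<close>)

lemma pseudo_expectation_add_measure:
  "pseudo_expectation (\<mu> + \<nu>) p = pseudo_expectation \<mu> p + pseudo_expectation \<nu> p"
proof -
  let ?B = "Poly_Mapping.keys \<mu> \<union> Poly_Mapping.keys \<nu>"
  have "pseudo_expectation \<rho> p = (\<Sum>v\<in>?B. Poly_Mapping.lookup \<rho> v * eval_poly p v)"
    if "\<rho> \<in> {\<mu>, \<nu>, \<mu> + \<nu>}" for \<rho>
    by (rule pseudo_expectation_superset) (use that keys_add[of \<mu> \<nu>] in auto)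
  then show ?thesis
    by (simp add: lookup_add distrib_right sum.distrib)
qed

lemma pseudo_expectation_sum_single:
  "pseudo_expectation (\<Sum>x\<in>A. Poly_Mapping.single (g x) (w x)) p
     = (\<Sum>x\<in>A. w x * eval_poly p (g x))"
proof (induction A rule: infinite_finite_induct)
  case (insert x A)
  have "pseudo_expectation (Poly_Mapping.single (g x) (w x)) p = w x * eval_poly p (g x)"
    by (simp add: pseudo_expectation_def)
  with insert show ?case by (simp add: pseudo_expectation_add_measure)
qed (simp_all add: pseudo_expectation_def)

lemma pseudo_expectation_add:
  "pseudo_expectation \<mu> (p + q) = pseudo_expectation \<mu> p + pseudo_expectation \<mu> q"
  by (simp add: pseudo_expectation_def eval_poly_eq_subst eval.poly_subst_add distrib_left
      sum.distrib)

lemma pseudo_expectation_cmult: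
  "pseudo_expectation \<mu> (PConst c * p) = c * pseudo_expectation \<mu> p"
  by (simp add: pseudo_expectation_def eval_poly_eq_subst eval.poly_subst_mult
      eval.poly_subst_PConst sum_distrib_left mult_ac)

lemma lookup_PConst_mult:
  "Poly_Mapping.lookup (PConst c * p) a = c * Poly_Mapping.lookup p a"
  by (simp add: PConst_def Poly_Mapping.map.rep_eq when_def flip: mult_map_scale_conv_mult)

text \<open>The image measure of \<open>\<mu>\<close> under \<open>\<iota>\<close>. As a sum of
  point masses it adds up the weights of points that have the same image.\<close>

definition push_measure :: "(real vec \<Rightarrow> real vec) \<Rightarrow> (real vec \<Rightarrow>\<^sub>0 real) \<Rightarrow> (real vec \<Rightarrow>\<^sub>0 real)" where
  "push_measure \<iota> \<mu> = (\<Sum>v\<in>Poly_Mapping.keys \<mu>. Poly_Mapping.single (\<iota> v) (Poly_Mapping.lookup \<mu> v))"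

text \<open>One map in two guises: \<open>\<iota>\<close> moves points, and
  \<open>\<sigma> i\<close> is its coordinate \<open>i\<close> as a polynomial. The degree bound
  lets constraints be transported without changing \<open>d\<close>.\<close>

locale linear_embedding =
  fixes n m :: nat and \<iota> :: "real vec \<Rightarrow> real vec" and \<sigma> :: "nat \<Rightarrow> mpoly"
  assumes carrier: "v \<in> carrier_vec n \<Longrightarrow> \<iota> v \<in> carrier_vec m"
    and coord: "v \<in> carrier_vec n \<Longrightarrow> i < m \<Longrightarrow> eval_poly (\<sigma> i) v = \<iota> v $ i"
    and in_polys: "\<sigma> i \<in> polys n"
    and degree: "total_degree (\<sigma> i) \<le> 1"
begin

text \<open>Change of variables: integrating \<open>p\<close> against the image measure is
  integrating \<open>p\<close> composed with \<open>\<iota>\<close>.\<close>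

lemma pseudo_expectation_push:
  assumes "Poly_Mapping.keys \<mu> \<subseteq> carrier_vec n" "p \<in> polys m"
  shows "pseudo_expectation (push_measure \<iota> \<mu>) p = pseudo_expectation \<mu> (poly_subst PConst \<sigma> p)"
proof -
  have "eval_poly p (\<iota> v) = eval_poly (poly_subst PConst \<sigma> p) v"
    if "v \<in> Poly_Mapping.keys \<mu>" for v
    unfolding eval_poly_subst unfolding eval_poly_eq_subst[of p]
    by (rule poly_subst_cong[OF assms(2)])
      (use coord that assms(1) in auto)
  then show ?thesis
    by (simp add: push_measure_def pseudo_expectation_sum_single)
      (simp add: pseudo_expectation_def)
qed

text \<open>A multiplier \<open>p\<close> for \<open>h\<close> pulls back to a multiplier for the
  pulled back \<open>h\<close>. The product is still a square times that constraint, and its degree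
  does not grow.\<close>

lemma satisfies_nonneg_push:
  assumes "Poly_Mapping.keys \<mu> \<subseteq> carrier_vec n" "h \<in> polys m"
    and "satisfies_nonneg d n \<mu> (poly_subst PConst \<sigma> h)"
  shows "satisfies_nonneg d m (push_measure \<iota> \<mu>) h"
  unfolding satisfies_nonneg_def
proof (intro ballI impI)
  fix p assume p: "p \<in> polys m" and d: "total_degree (p ^ 2 * h) \<le> d"
  let ?s = "poly_subst PConst \<sigma>"
  have s: "?s (p ^ 2 * h) = ?s p ^ 2 * ?s h"
    by (simp add: subst.poly_subst_mult subst.poly_subst_power)
  have "total_degree (?s p ^ 2 * ?s h) \<le> d"
    using total_degree_subst_le[of \<sigma> "p ^ 2 * h", OF degree] d unfolding s by simp
  with assms(3) have "0 \<le> pseudo_expectation \<mu> (?s p ^ 2 * ?s h)"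
    by (simp add: satisfies_nonneg_def polys_subst in_polys)
  then show "0 \<le> pseudo_expectation (push_measure \<iota> \<mu>) (p ^ 2 * h)"
    using pseudo_expectation_push[OF assms(1), of "p ^ 2 * h"] p assms(2)
    by (simp add: s polys_intros)
qed

lemma satisfies_zero_push:
  assumes "Poly_Mapping.keys \<mu> \<subseteq> carrier_vec n" "h \<in> polys m"
    and "satisfies_zero d n \<mu> (poly_subst PConst \<sigma> h)"
  shows "satisfies_zero d m (push_measure \<iota> \<mu>) h"
  using assms by (simp add: satisfies_zero_def satisfies_nonneg_push polys_intros
      subst.poly_subst_uminus)

lemma pseudo_distribution_push:
  assumes "pseudo_distribution d n \<mu>"
  shows "pseudo_distribution d m (push_measure \<iota> \<mu>)"
proof -
  have c: "Poly_Mapping.keys \<mu> \<subseteq> carrier_vec n"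
    using assms by (simp add: pseudo_distribution_def)
  have "Poly_Mapping.keys (push_measure \<iota> \<mu>) \<subseteq> \<iota> ` Poly_Mapping.keys \<mu>"
    unfolding push_measure_def
    by (rule order_trans[OF keys_sum]) auto
  then have "Poly_Mapping.keys (push_measure \<iota> \<mu>) \<subseteq> carrier_vec m"
    using c carrier by blast
  moreover have "pseudo_expectation (push_measure \<iota> \<mu>) (q ^ 2) \<ge> 0"
    if q: "q \<in> polys m" and d: "real (total_degree q) \<le> real d / 2" for q
  proof -
    have "real (total_degree (poly_subst PConst \<sigma> q)) \<le> real d / 2"
      using total_degree_subst_le[of \<sigma> q, OF degree] d by linarith
    then show ?thesis
      using assms q by (simp add: pseudo_expectation_push[OF c] polys_intros
          subst.poly_subst_power pseudo_distribution_def polys_subst in_polys)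
  qed
  ultimately show ?thesis
    using assms pseudo_expectation_push[OF c polys_one]
    by (simp add: pseudo_distribution_def subst.poly_subst_one)
qed

end

text \<open>The premise bounds \<open>deg p\<^sup>2 (q - \<delta> L)\<close> only; multiplicativity of the degree over a field turns
  this into bounds on \<open>deg p\<^sup>2 (q - \<delta>)\<close> and \<open>deg p\<^sup>2 (L - 1)\<close>, the degrees in which the hypotheses
  may be used. Homogeneity excludes cancellation between \<open>q\<close> and \<open>L\<close>.\<close>

lemma satisfies_nonneg_diff_linear:
  assumes q: "satisfies_nonneg d n \<mu> (q - PConst \<delta>)" and L: "satisfies_zero d n \<mu> (L - 1)"
    and hom_q: "\<And>a. a \<in> Poly_Mapping.keys q \<Longrightarrow> monom_degree a = 2"
    and hom_L: "\<And>a. a \<in> Poly_Mapping.keys L \<Longrightarrow> monom_degree a = 1"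
    and "L \<noteq> 0" "\<delta> > 0"
  shows "satisfies_nonneg d n \<mu> (q - PConst \<delta> * L)"
  unfolding satisfies_nonneg_def
proof (intro ballI impI)
  let ?h = "q - PConst \<delta> * L"
  fix p assume p: "p \<in> polys n" and d: "total_degree (p ^ 2 * ?h) \<le> d"
  have lookup_PConst: "Poly_Mapping.lookup (PConst r) a = (if monom_degree a = 0 \<and> a = 0 then r else 0)"
    for r a by (auto simp: PConst_def lookup_single when_def monom_degree_def)
  have lookup_h: "Poly_Mapping.lookup ?h a = Poly_Mapping.lookup q a - \<delta> * Poly_Mapping.lookup L a" for a
    by (simp add: lookup_minus lookup_PConst_mult)
  have q_key: "Poly_Mapping.lookup q a = 0" if "monom_degree a \<noteq> 2" for a
    using that hom_q by (auto simp: in_keys_iff)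
  have L_key: "Poly_Mapping.lookup L a = 0" if "monom_degree a \<noteq> 1" for a
    using that hom_L by (auto simp: in_keys_iff)
  obtain b where b: "b \<in> Poly_Mapping.keys L"
    using \<open>L \<noteq> 0\<close> by (meson ex_in_conv keys_eq_empty)
  \<comment> \<open>\<open>q\<close> has no monomials of degree 1, so the linear term of
    \<open>\<delta> L\<close> survives. Hence \<open>?h\<close> is nonzero of degree at least 1, the
    degree of \<open>L\<close>.\<close>
  then have "b \<in> Poly_Mapping.keys ?h"
    using \<open>\<delta> > 0\<close> hom_L[OF b] q_key[of b] by (simp add: in_keys_iff lookup_h)
  then have one: "1 \<le> total_degree ?h" and nz: "?h \<noteq> 0"
    using monom_degree_le_total_degree[of b ?h] hom_L[OF b] by auto
  have deg_q: "total_degree (q - PConst \<delta>) \<le> total_degree ?h"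
    unfolding total_degree_le_iff
  proof
    fix a assume "a \<in> Poly_Mapping.keys (q - PConst \<delta>)"
    then have "monom_degree a = 0 \<or> a \<in> Poly_Mapping.keys ?h"
      using L_key[of a] hom_q[of a]
      by (auto simp: in_keys_iff lookup_minus lookup_PConst lookup_PConst_mult split: if_splits)
    then show "monom_degree a \<le> total_degree ?h"
      using monom_degree_le_total_degree by auto
  qed
  have deg_L: "total_degree (1 - L) \<le> total_degree ?h"
    using keys_diff[of 1 L] hom_L one by (fastforce simp: total_degree_le_iff monom_degree_def)
  show "0 \<le> pseudo_expectation \<mu> (p ^ 2 * ?h)"
  \<comment> \<open>Additivity of the degree holds for nonzero factors only.\<close>
  proof (cases "p = 0")
    case True
    then show ?thesis by (simp add: pseudo_expectation_def eval_poly_def)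
  next
    case False
    have le: "total_degree (p ^ 2 * g) \<le> d" if "total_degree g \<le> total_degree ?h" for g
      using total_degree_mult_le[of "p ^ 2" g] total_degree_mult[of "p ^ 2" ?h] d that False nz
      by simp
    have "0 \<le> pseudo_expectation \<mu> (p ^ 2 * (q - PConst \<delta>))"
      using q p le[OF deg_q] by (simp add: satisfies_nonneg_def)
    moreover have "0 \<le> pseudo_expectation \<mu> (p ^ 2 * (1 - L))"
      using L p le[OF deg_L] by (simp add: satisfies_nonneg_def satisfies_zero_def)
    \<comment> \<open>Writing q - \<delta> L = (q - \<delta>) + \<delta> (1 - L) exhibits the target
      as a nonnegative combination of the two known constraints.\<close>
    moreover have "p ^ 2 * ?h = p ^ 2 * (q - PConst \<delta>) + PConst \<delta> * (p ^ 2 * (1 - L))"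
      by (simp add: algebra_simps)
    ultimately show ?thesis
      using \<open>\<delta> > 0\<close> by (simp only: pseudo_expectation_add pseudo_expectation_cmult) simp
  qed
qed


section \<open>The pseudo-equilibrium of the combined game\<close>

text \<open>The coordinates are x, K zeros, y, K zeros. Coordinate j of y moves from position N + j
  to N + K + j, which explains the shift \<open>i - K\<close>.\<close>

definition pad :: "nat \<Rightarrow> nat \<Rightarrow> real vec \<Rightarrow> real vec" where
  "pad N K v = vec (2 * (N + K)) (\<lambda>i. if i < N then v $ i
     else if N + K \<le> i \<and> i < N + K + N then v $ (i - K) else 0)"

definition pad_var :: "nat \<Rightarrow> nat \<Rightarrow> nat \<Rightarrow> mpoly" where
  "pad_var N K i = (if i < N then PVar i
     else if N + K \<le> i \<and> i < N + K + N then PVar (i - K) else 0)"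

interpretation pad: linear_embedding "2 * N" "2 * (N + K)" "pad N K" "pad_var N K" for N K
proof
  have "total_degree 0 \<le> 1"
    by (simp add: total_degree_def)
  then show "total_degree (pad_var N K i) \<le> 1" for i
    by (simp add: pad_var_def total_degree_PVar)
qed (auto simp: pad_def pad_var_def eval_poly_eq_subst eval.poly_subst_PVar eval.poly_subst_zero
    intro: polys_intros)

lemma pad_var_simps:
  "i < N \<Longrightarrow> pad_var N K i = PX N i" "N \<le> i \<Longrightarrow> i < N + K \<Longrightarrow> pad_var N K i = 0"
  "j < N \<Longrightarrow> pad_var N K (N + K + j) = PY N j"
  "N \<le> j \<Longrightarrow> pad_var N K (N + K + j) = 0"
  by (auto simp: pad_var_def PX_def PY_def)

lemma sum_lessThan_add_zero:
  fixes g :: "nat \<Rightarrow> 'a::comm_monoid_add"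
  assumes "\<And>i. N \<le> i \<Longrightarrow> i < N + K \<Longrightarrow> g i = 0"
  shows "(\<Sum>i<N + K. g i) = (\<Sum>i<N. g i)"
  by (rule sum.mono_neutral_right) (use assms in auto)

lemmas subst_simps = subst.poly_subst_sum subst.poly_subst_mult subst.poly_subst_PConst
  subst.poly_subst_PVar subst.poly_subst_diff subst.poly_subst_one

lemma pad_PX: "i < N + K \<Longrightarrow>
    poly_subst PConst (pad_var N K) (PX (N + K) i) = (if i < N then PX N i else 0)"
  by (simp add: PX_def[of "N + K"] subst_simps pad_var_simps)

lemma pad_PY: "poly_subst PConst (pad_var N K) (PY (N + K) j) = (if j < N then PY N j else 0)"
  by (simp add: PY_def[of "N + K"] subst_simps pad_var_simps)

lemma pad_sum_PX:
  "poly_subst PConst (pad_var N K) (\<Sum>i<N + K. PX (N + K) i) = (\<Sum>i<N. PX N i)"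
  by (simp add: subst_simps pad_PX sum_lessThan_add_zero)

lemma pad_sum_PY:
  "poly_subst PConst (pad_var N K) (\<Sum>i<N + K. PY (N + K) i) = (\<Sum>i<N. PY N i)"
  by (simp add: subst_simps pad_PY sum_lessThan_add_zero)

context
  fixes N K :: nat and A B C D :: "real mat"
  assumes A: "A \<in> carrier_mat N N" and D: "D \<in> carrier_mat K K"
begin

lemma pad_payoff_poly:
  "poly_subst PConst (pad_var N K) (payoff_poly (N + K) (four_block_mat A B C D)) = payoff_poly N A"
  using A D by (simp add: payoff_poly_def subst_simps pad_PX pad_PY sum_lessThan_add_zero)

text \<open>After padding, the opponent plays in the first block only, so a row of the second block
  meets just the lower left block \<open>C\<close>. In the combined game this block is constantly
  \<delta>, giving \<delta> times the sum of the y variables.\<close>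

lemma pad_row_payoff_poly:
  "i < N + K \<Longrightarrow> poly_subst PConst (pad_var N K) (row_payoff_poly (N + K) (four_block_mat A B C D) i) =
     (if i < N then row_payoff_poly N A i else row_payoff_poly N C (i - N))"
  using A D by (simp add: row_payoff_poly_def subst_simps pad_PY sum_lessThan_add_zero)

lemma pad_col_payoff_poly:
  "j < N + K \<Longrightarrow> poly_subst PConst (pad_var N K) (col_payoff_poly (N + K) (four_block_mat A B C D) j) =
     (if j < N then col_payoff_poly N A j else col_payoff_poly N B (j - N))"
  using A D by (simp add: col_payoff_poly_def subst_simps pad_PX sum_lessThan_add_zero)

end

lemma payoff_poly_in_polys:
  "payoff_poly m A \<in> polys (2 * m)"
  "i < m \<Longrightarrow> row_payoff_poly m A i \<in> polys (2 * m)"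
  "i < m \<Longrightarrow> col_payoff_poly m A i \<in> polys (2 * m)"
  "i < m \<Longrightarrow> PX m i \<in> polys (2 * m)" "i < m \<Longrightarrow> PY m i \<in> polys (2 * m)"
  by (auto simp: payoff_poly_def row_payoff_poly_def col_payoff_poly_def PX_def PY_def
      intro!: polys_intros)

lemma monom_degree_payoff_poly:
  assumes "a \<in> Poly_Mapping.keys (payoff_poly m A)"
  shows "monom_degree a = 2"
proof -
  have deg: "monom_degree (Poly_Mapping.single k (Suc 0)) = 1" for k
    by (simp add: monom_degree_def)
  have mono: "PConst c * PX m i * PY m j =
      Poly_Mapping.single (Poly_Mapping.single i 1 + Poly_Mapping.single (m + j) 1) c" for c i j
    by (simp add: PConst_def PX_def PY_def PVar_def mult_single)
  from assms obtain i j c where "a \<in> Poly_Mapping.keys (PConst c * PX m i * PY m j)"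
    unfolding payoff_poly_def by (blast dest: subsetD[OF keys_sum])
  then show ?thesis
    by (auto simp: mono monom_degree_add deg split: if_splits)
qed

text \<open>Supplies the two facts about L in \<open>satisfies_nonneg_diff_linear\<close>. Distinct
  variables do not cancel: the coefficient of each chosen variable is exactly 1.\<close>

lemma sum_PVar:
  assumes "finite I" "I \<noteq> {}" "inj_on g I"
  shows "(\<Sum>i\<in>I. PVar (g i)) \<noteq> 0"
    and "a \<in> Poly_Mapping.keys (\<Sum>i\<in>I. PVar (g i)) \<Longrightarrow> monom_degree a = 1"
proof -
  obtain j where j: "j \<in> I" using assms by blast
  have inj: "Poly_Mapping.single (g i) (1::nat) = Poly_Mapping.single (g j) 1 \<longleftrightarrow> i = j"
    if "i \<in> I" for i
    using that j assms(3) by (metis inj_onD lookup_single_eq lookup_single_not_eq zero_neq_one)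
  have "Poly_Mapping.lookup (\<Sum>i\<in>I. PVar (g i)) (Poly_Mapping.single (g j) 1) =
      (\<Sum>i\<in>I. if i = j then 1 else 0)"
    unfolding lookup_sum by (rule sum.cong) (simp_all add: PVar_def lookup_single when_def inj del: One_nat_def)
  then show "(\<Sum>i\<in>I. PVar (g i)) \<noteq> 0"
    using assms(1) j by auto
next
  assume "a \<in> Poly_Mapping.keys (\<Sum>i\<in>I. PVar (g i))"
  then obtain i where "a \<in> Poly_Mapping.keys (PVar (g i))"
    by (blast dest: subsetD[OF keys_sum])
  then show "monom_degree a = 1"
    by (simp add: PVar_def monom_degree_def)
qed

text \<open>Deviations inside the first block pull back to the constraints of (R, C), those into the
  second block to payoff minus \<delta> times a sum of variables. No entry of \<open>RS\<close> or
  \<open>CS\<close> survives the padding, so one measure serves every choice of second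
  block.\<close>

lemma pseudo_equilibrium_combined:
  assumes eq: "pseudo_equilibrium t N R C \<mu>"
    and R\<delta>: "satisfies_nonneg t (2 * N) \<mu> (payoff_poly N R - PConst \<delta>)"
    and C\<delta>: "satisfies_nonneg t (2 * N) \<mu> (payoff_poly N C - PConst \<delta>)"
    and mats: "R \<in> carrier_mat N N" "C \<in> carrier_mat N N" "RS \<in> carrier_mat K K" "CS \<in> carrier_mat K K"
    and "N > 0" "\<delta> > 0"
  shows "pseudo_equilibrium t (N + K) (combined_row N K \<delta> R RS) (combined_col N K \<delta> C CS)
           (push_measure (pad N K) \<mu>)"
proof -
  note eq = eq[unfolded pseudo_equilibrium_def]
  have keys: "Poly_Mapping.keys \<mu> \<subseteq> carrier_vec (2 * N)"
    using eq by (simp add: pseudo_distribution_def)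
  \<comment> \<open>The nonnegativity constraints of the padded coordinates pull back to the zero
    polynomial.\<close>
  have zero: "satisfies_nonneg t (2 * N) \<mu> 0"
    by (simp add: satisfies_nonneg_def pseudo_expectation_def eval_poly_def)
  have inj: "inj_on (\<lambda>i. i) {..<N}" "inj_on ((+) N) {..<N}"
    by simp_all
  have Y: "satisfies_nonneg t (2 * N) \<mu> (payoff_poly N R - PConst \<delta> * (\<Sum>i<N. PY N i))"
    by (rule satisfies_nonneg_diff_linear[OF R\<delta>])
      (use eq \<open>N > 0\<close> \<open>\<delta> > 0\<close> sum_PVar[OF _ _ inj(2)]
        in \<open>auto simp: PY_def monom_degree_payoff_poly lessThan_empty_iff\<close>)
  have X: "satisfies_nonneg t (2 * N) \<mu> (payoff_poly N C - PConst \<delta> * (\<Sum>i<N. PX N i))"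
    by (rule satisfies_nonneg_diff_linear[OF C\<delta>])
      (use eq \<open>N > 0\<close> \<open>\<delta> > 0\<close> sum_PVar[OF _ _ inj(1)]
        in \<open>auto simp: PX_def monom_degree_payoff_poly lessThan_empty_iff\<close>)
  have row: "row_payoff_poly N (\<delta> \<cdot>\<^sub>m ones_mat K N) i = PConst \<delta> * (\<Sum>i<N. PY N i)" if "i < K" for i
    using that by (simp add: row_payoff_poly_def ones_mat_def sum_distrib_left)
  have col: "col_payoff_poly N (\<delta> \<cdot>\<^sub>m ones_mat N K) i = PConst \<delta> * (\<Sum>i<N. PX N i)" if "i < K" for i
    using that by (simp add: col_payoff_poly_def ones_mat_def sum_distrib_left)
  show ?thesis
    unfolding pseudo_equilibrium_def
  proof (intro conjI allI impI)
    show "pseudo_distribution t (2 * (N + K)) (push_measure (pad N K) \<mu>)"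
      by (rule pad.pseudo_distribution_push) (use eq in simp)
  next
    fix i assume i: "i < N + K"
    show "satisfies_nonneg t (2 * (N + K)) (push_measure (pad N K) \<mu>) (PX (N + K) i)"
      by (rule pad.satisfies_nonneg_push[OF keys payoff_poly_in_polys(4)[OF i]])
        (use eq i zero in \<open>auto simp: pad_PX\<close>)
    show "satisfies_nonneg t (2 * (N + K)) (push_measure (pad N K) \<mu>) (PY (N + K) i)"
      by (rule pad.satisfies_nonneg_push[OF keys payoff_poly_in_polys(5)[OF i]])
        (use eq i zero in \<open>auto simp: pad_PY\<close>)
    show "satisfies_nonneg t (2 * (N + K)) (push_measure (pad N K) \<mu>)
        (payoff_poly (N + K) (combined_row N K \<delta> R RS) -
         row_payoff_poly (N + K) (combined_row N K \<delta> R RS) i)"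
      by (rule pad.satisfies_nonneg_push[OF keys polys_diff[OF payoff_poly_in_polys(1) payoff_poly_in_polys(2)[OF i]]])
        (use eq i Y mats row in \<open>auto simp: combined_row_def pad_payoff_poly pad_row_payoff_poly
          subst.poly_subst_diff\<close>)
    show "satisfies_nonneg t (2 * (N + K)) (push_measure (pad N K) \<mu>)
        (payoff_poly (N + K) (combined_col N K \<delta> C CS) -
         col_payoff_poly (N + K) (combined_col N K \<delta> C CS) i)"
      by (rule pad.satisfies_nonneg_push[OF keys polys_diff[OF payoff_poly_in_polys(1) payoff_poly_in_polys(3)[OF i]]])
        (use eq i X mats col in \<open>auto simp: combined_col_def pad_payoff_poly pad_col_payoff_poly
          subst.poly_subst_diff\<close>)
  next
    show "satisfies_zero t (2 * (N + K)) (push_measure (pad N K) \<mu>) ((\<Sum>i<N + K. PX (N + K) i) - 1)"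
      by (rule pad.satisfies_zero_push[OF keys polys_diff[OF polys_sum[OF payoff_poly_in_polys(4)] polys_one]])
        (use eq in \<open>simp_all add: subst.poly_subst_diff subst.poly_subst_one pad_sum_PX\<close>)
    show "satisfies_zero t (2 * (N + K)) (push_measure (pad N K) \<mu>) ((\<Sum>i<N + K. PY (N + K) i) - 1)"
      by (rule pad.satisfies_zero_push[OF keys polys_diff[OF polys_sum[OF payoff_poly_in_polys(5)] polys_one]])
        (use eq in \<open>simp_all add: subst.poly_subst_diff subst.poly_subst_one pad_sum_PY\<close>)
  qed
qed

section \<open>Well-supported equilibria\<close>

text \<open>Keeps the pure payoffs \<open>(A *\<^sub>v y) $ i\<close> as atoms, instead of letting
  the simplifier unfold them into scalar products with rows.\<close>

declare index_mult_mat_vec [simp del]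

text \<open>One player's half of an approximate well-supported equilibrium. The column player's half
  is the same predicate for the transposed matrix with \<open>x\<close> and \<open>y\<close>
  exchanged.\<close>

definition well_supported :: "nat \<Rightarrow> real mat \<Rightarrow> real \<Rightarrow> real vec \<Rightarrow> real vec \<Rightarrow> bool" where
  "well_supported m A \<epsilon> x y \<longleftrightarrow>
     (\<forall>i<m. x $ i > 0 \<longrightarrow> (\<forall>k<m. (A *\<^sub>v y) $ k \<le> (A *\<^sub>v y) $ i + \<epsilon>))"

lemma simplexD:
  assumes "x \<in> simplex m"
  shows "x \<in> carrier_vec m" "i < m \<Longrightarrow> 0 \<le> x $ i" "(\<Sum>i<m. x $ i) = 1" "m > 0"
  using assms by (auto simp: simplex_def intro: gr0I)

lemma simplexI:
  assumes "x \<in> carrier_vec m" "\<And>i. i < m \<Longrightarrow> 0 \<le> x $ i" "(\<Sum>i<m. x $ i) = 1"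
  shows "x \<in> simplex m"
proof -
  have "x $ i \<le> 1" if "i < m" for i
    using member_le_sum[of i "{..<m}" "($) x"] assms that by simp
  with assms show ?thesis by (simp add: simplex_def)
qed

lemma mult_mat_vec_sum:
  "A \<in> carrier_mat n m \<Longrightarrow> y \<in> carrier_vec m \<Longrightarrow> i < n \<Longrightarrow>
    (A *\<^sub>v y) $ i = (\<Sum>j<m. A $$ (i, j) * y $ j)"
  by (auto simp: index_mult_mat_vec scalar_prod_def lessThan_atLeast0)

lemma payoff_sum:
  "A \<in> carrier_mat n m \<Longrightarrow> x \<in> carrier_vec n \<Longrightarrow> payoff x A y = (\<Sum>i<n. x $ i * (A *\<^sub>v y) $ i)"
  by (auto simp: payoff_def scalar_prod_def lessThan_atLeast0)

lemma payoff_transpose: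
  assumes "A \<in> carrier_mat n m" "x \<in> carrier_vec n" "y \<in> carrier_vec m"
  shows "payoff x A y = payoff y A\<^sup>T x"
  unfolding payoff_def
  using transpose_vec_mult_scalar[OF assms(1,3,2)] comm_scalar_prod[of y m "A\<^sup>T *\<^sub>v x"] assms
  by auto

lemma payoff_unit_left:
  "A \<in> carrier_mat n m \<Longrightarrow> i < n \<Longrightarrow> payoff (unit_vec n i) A y = (A *\<^sub>v y) $ i"
  by (auto simp: payoff_def carrier_vecI intro!: scalar_prod_left_unit[of _ n])

lemma payoff_unit_right:
  "A \<in> carrier_mat n m \<Longrightarrow> x \<in> carrier_vec n \<Longrightarrow> j < m \<Longrightarrow>
    payoff x A (unit_vec m j) = (A\<^sup>T *\<^sub>v x) $ j"
  by (subst payoff_transpose) (auto intro!: payoff_unit_left)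

lemma eps_NE_iff:
  assumes "R \<in> carrier_mat m m" "C \<in> carrier_mat m m"
  shows "eps_NE m R C \<epsilon> x y \<longleftrightarrow> x \<in> simplex m \<and> y \<in> simplex m \<and>
     (\<forall>i<m. (R *\<^sub>v y) $ i \<le> (\<Sum>i<m. x $ i * (R *\<^sub>v y) $ i) + \<epsilon>) \<and>
     (\<forall>j<m. (C\<^sup>T *\<^sub>v x) $ j \<le> (\<Sum>j<m. y $ j * (C\<^sup>T *\<^sub>v x) $ j) + \<epsilon>)"
proof -
  have "payoff x C y = (\<Sum>j<m. y $ j * (C\<^sup>T *\<^sub>v x) $ j)" if "x \<in> simplex m" "y \<in> simplex m"
    using that assms payoff_transpose[of C m m x y] payoff_sum[of "C\<^sup>T" m m y x] by (simp add: simplexD(1))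
  then show ?thesis
    unfolding eps_NE_def using assms payoff_sum[OF assms(1), of x y]
    by (auto simp: payoff_unit_left payoff_unit_right simplexD(1) algebra_simps)
qed

lemma eps_WNE_iff:
  assumes "R \<in> carrier_mat m m" "C \<in> carrier_mat m m"
  shows "eps_WNE m R C \<epsilon> x y \<longleftrightarrow> x \<in> simplex m \<and> y \<in> simplex m \<and>
     well_supported m R \<epsilon> x y \<and> well_supported m C\<^sup>T \<epsilon> y x"
proof -
  have Max_le: "u \<ge> Max (g ` {..<m}) - \<epsilon> \<longleftrightarrow> (\<forall>k<m. g k \<le> u + \<epsilon>)" if "m > 0" for u and g :: "nat \<Rightarrow> real"
  proof -
    have "Max (g ` {..<m}) \<le> u + \<epsilon> \<longleftrightarrow> (\<forall>k<m. g k \<le> u + \<epsilon>)"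
      using that by (subst Max_le_iff) (auto simp: lessThan_empty_iff)
    then show ?thesis by (simp add: algebra_simps)
  qed
  show ?thesis
    unfolding eps_WNE_def well_supported_def using assms Max_le
    by (auto simp: payoff_unit_left payoff_unit_right simplexD(1,4))
qed

text \<open>Pure strategies more than \<open>k\<close> below the best response carry mass at most \<open>\<epsilon> / k\<close>.\<close>

lemma drop_bad_strategies:
  fixes u :: "nat \<Rightarrow> real"
  assumes x: "x \<in> simplex m" and u: "\<And>i. i < m \<Longrightarrow> u i \<le> (\<Sum>i<m. x $ i * u i) + \<epsilon>"
    and "0 < k" "\<epsilon> < k"
  obtains x' where "x' \<in> simplex m" "\<And>i l. i < m \<Longrightarrow> x' $ i > 0 \<Longrightarrow> l < m \<Longrightarrow> u l \<le> u i + k"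
    "(\<Sum>i<m. \<bar>x $ i - x' $ i\<bar>) \<le> 2 * \<epsilon> / k"
proof -
  note xD = simplexD[OF x]
  define M where "M = Max (u ` {..<m})"
  have M: "u i \<le> M" if "i < m" for i
    using that by (simp add: M_def)
  have "M \<in> u ` {..<m}"
    unfolding M_def by (rule Max_in) (use xD(4) in \<open>auto simp: lessThan_empty_iff\<close>)
  then have M_le: "M \<le> (\<Sum>i<m. x $ i * u i) + \<epsilon>"
    using u by auto
  define G where "G = {i \<in> {..<m}. M - k \<le> u i}"
  define g where "g = (\<Sum>i\<in>G. x $ i)"
  have part: "sum h {..<m} = sum h G + sum h ({..<m} - G)" for h :: "nat \<Rightarrow> real"
    by (subst add.commute, rule sum.subset_diff) (auto simp: G_def)
  have rest: "(\<Sum>i\<in>{..<m} - G. x $ i) = 1 - g"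
    using part[of "($) x"] xD(3) by (simp add: g_def)
  \<comment> \<open>Markov's inequality for the regret: strategies outside \<open>G\<close> lose at
    least k against the best payoff \<open>M\<close>, while the average regret is at most
    \<epsilon>.\<close>
  have "(\<Sum>i<m. x $ i * u i) \<le> (\<Sum>i\<in>G. x $ i * M) + (\<Sum>i\<in>{..<m} - G. x $ i * (M - k))"
    unfolding part[of "\<lambda>i. x $ i * u i"]
    by (intro add_mono sum_mono mult_left_mono) (auto simp: G_def M xD(2))
  also have "\<dots> = g * M + (1 - g) * (M - k)"
    by (simp only: rest g_def flip: sum_distrib_right)
  finally have "k * (1 - g) \<le> \<epsilon>"
    using M_le by (simp add: algebra_simps)
  then have bound: "1 - g \<le> \<epsilon> / k"
    using \<open>0 < k\<close> by (simp add: field_simps)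
  also have "\<dots> < 1" using \<open>0 < k\<close> \<open>\<epsilon> < k\<close> by simp
  finally have "g > 0" by simp
  have "g \<le> 1"
    using rest sum_nonneg[of "{..<m} - G" "($) x"] xD(2) by auto
  define x' where "x' = vec m (\<lambda>i. if i \<in> G then x $ i / g else 0)"
  have GD: "i < m" if "i \<in> G" for i
    using that by (simp add: G_def)
  show ?thesis
  proof (rule that)
    have "(\<Sum>i<m. x' $ i) = (\<Sum>i\<in>G. x $ i / g)"
      unfolding part by (simp add: x'_def GD)
    also have "\<dots> = 1"
      using \<open>g > 0\<close> by (simp add: g_def flip: sum_divide_distrib)
    finally show "x' \<in> simplex m"
      by (intro simplexI) (use \<open>g > 0\<close> xD(2) in \<open>auto simp: x'_def\<close>)
  next
    fix i l assume "i < m" "x' $ i > 0" "l < m"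
    then have "i \<in> G" by (auto simp: x'_def split: if_splits)
    then show "u l \<le> u i + k" using M[OF \<open>l < m\<close>] by (simp add: G_def)
  next
    \<comment> \<open>Renormalizing only raises the coordinates in \<open>G\<close>, so the mass
      gained there and the mass deleted outside are both \<open>1 - g\<close>, which gives the
      factor 2.\<close>
    have "x $ i \<le> x $ i / g" if "i \<in> G" for i
      using \<open>g > 0\<close> \<open>g \<le> 1\<close> xD(2)[OF GD[OF that]] by (simp add: pos_le_divide_eq mult_left_le)
    then have "(\<Sum>i<m. \<bar>x $ i - x' $ i\<bar>) = (\<Sum>i\<in>G. x $ i / g - x $ i) + (\<Sum>i\<in>{..<m} - G. x $ i)"
      unfolding part by (intro arg_cong2[where f = "(+)"] sum.cong) (auto simp: x'_def GD xD(2))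
    also have "(\<Sum>i\<in>G. x $ i / g - x $ i) = 1 - g"
      using \<open>g > 0\<close> by (simp add: sum_subtractf g_def flip: sum_divide_distrib)
    finally show "(\<Sum>i<m. \<bar>x $ i - x' $ i\<bar>) \<le> 2 * \<epsilon> / k"
      using bound rest by simp
  qed
qed

text \<open>With entries bounded by 2, moving the opponent by r in l1 distance shifts each pure
  payoff by at most 2r. A comparison involves two of them.\<close>

lemma well_supported_perturb:
  assumes A: "A \<in> carrier_mat m m" "\<And>i j. i < m \<Longrightarrow> j < m \<Longrightarrow> \<bar>A $$ (i, j)\<bar> \<le> 2"
    and y: "y \<in> carrier_vec m" "y' \<in> carrier_vec m" "(\<Sum>j<m. \<bar>y $ j - y' $ j\<bar>) \<le> r"
    and ws: "well_supported m A k x y"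
  shows "well_supported m A (k + 4 * r) x y'"
proof -
  have close: "\<bar>(A *\<^sub>v y) $ i - (A *\<^sub>v y') $ i\<bar> \<le> 2 * r" if "i < m" for i
  proof -
    have "(A *\<^sub>v y) $ i - (A *\<^sub>v y') $ i = (\<Sum>j<m. A $$ (i, j) * (y $ j - y' $ j))"
      using that A(1) y(1,2) mult_mat_vec_sum[of A m m]
      by (simp add: sum_subtractf right_diff_distrib)
    also have "\<bar>\<dots>\<bar> \<le> (\<Sum>j<m. 2 * \<bar>y $ j - y' $ j\<bar>)"
      using that A(2) by (intro order_trans[OF sum_abs] sum_mono) (simp add: abs_mult mult_right_mono)
    also have "\<dots> \<le> 2 * r"
      using y(3) by (simp flip: sum_distrib_left)
    finally show ?thesis .
  qed
  show ?thesis
    unfolding well_supported_def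
  proof (intro allI impI)
    fix i l assume "i < m" "0 < x $ i" "l < m"
    then have "(A *\<^sub>v y) $ l \<le> (A *\<^sub>v y) $ i + k"
      using ws by (simp add: well_supported_def)
    then show "(A *\<^sub>v y') $ l \<le> (A *\<^sub>v y') $ i + (k + 4 * r)"
      using close[OF \<open>i < m\<close>] close[OF \<open>l < m\<close>] by linarith
  qed
qed

lemma well_supported_mono:
  "well_supported m A \<epsilon> x y \<Longrightarrow> \<epsilon> \<le> \<epsilon>' \<Longrightarrow> well_supported m A \<epsilon>' x y"
  by (force simp: well_supported_def)

text \<open>The threshold \<open>\<epsilon> / 5\<close> is chosen so that \<open>\<epsilon> / 5 + 8 (\<epsilon> / 15)\<^sup>2 / (\<epsilon> / 5) \<le> \<epsilon> / 2\<close>.\<close>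

lemma eps_NE_near_eps_WNE:
  assumes R: "R \<in> carrier_mat m m" "\<And>i j. i < m \<Longrightarrow> j < m \<Longrightarrow> \<bar>R $$ (i, j)\<bar> \<le> 2"
    and C: "C \<in> carrier_mat m m" "\<And>i j. i < m \<Longrightarrow> j < m \<Longrightarrow> \<bar>C $$ (i, j)\<bar> \<le> 2"
    and \<epsilon>: "0 < \<epsilon>" "\<epsilon> \<le> 1" "\<epsilon>' \<le> (\<epsilon> / 15)\<^sup>2"
    and ne: "eps_NE m R C \<epsilon>' x y"
  obtains x' y' where "eps_WNE m R C (\<epsilon> / 2) x' y'"
    "(\<Sum>i<m. \<bar>x $ i - x' $ i\<bar>) \<le> 2 * \<epsilon> / 45" "(\<Sum>i<m. \<bar>y $ i - y' $ i\<bar>) \<le> 2 * \<epsilon> / 45"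
proof -
  note ne = ne[unfolded eps_NE_iff[OF R(1) C(1)]]
  have "\<epsilon>' \<le> \<epsilon> * \<epsilon> / 225" using \<epsilon>(3) by (simp add: power2_eq_square)
  moreover have "\<epsilon> * \<epsilon> \<le> \<epsilon> * 1" using \<epsilon>(1,2) by (intro mult_left_mono) auto
  ultimately have small: "\<epsilon>' < \<epsilon> / 5" using \<epsilon>(1) by linarith
  have k: "0 < \<epsilon> / 5" and bound: "2 * \<epsilon>' / (\<epsilon> / 5) \<le> 2 * \<epsilon> / 45"
    using \<epsilon>(1) \<open>\<epsilon>' \<le> \<epsilon> * \<epsilon> / 225\<close> by (simp_all add: field_simps)
  have xy: "x \<in> simplex m" "y \<in> simplex m"
    using ne by auto
  have ux: "(R *\<^sub>v y) $ i \<le> (\<Sum>i<m. x $ i * (R *\<^sub>v y) $ i) + \<epsilon>'"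
    and uy: "(C\<^sup>T *\<^sub>v x) $ i \<le> (\<Sum>i<m. y $ i * (C\<^sup>T *\<^sub>v x) $ i) + \<epsilon>'" if "i < m" for i
    using ne that by auto
  obtain x' where x': "x' \<in> simplex m"
    "\<And>i l. i < m \<Longrightarrow> x' $ i > 0 \<Longrightarrow> l < m \<Longrightarrow> (R *\<^sub>v y) $ l \<le> (R *\<^sub>v y) $ i + \<epsilon> / 5"
    "(\<Sum>i<m. \<bar>x $ i - x' $ i\<bar>) \<le> 2 * \<epsilon>' / (\<epsilon> / 5)"
    using drop_bad_strategies[OF xy(1) ux k small] by blast
  obtain y' where y': "y' \<in> simplex m"
    "\<And>i l. i < m \<Longrightarrow> y' $ i > 0 \<Longrightarrow> l < m \<Longrightarrow> (C\<^sup>T *\<^sub>v x) $ l \<le> (C\<^sup>T *\<^sub>v x) $ i + \<epsilon> / 5"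
    "(\<Sum>i<m. \<bar>y $ i - y' $ i\<bar>) \<le> 2 * \<epsilon>' / (\<epsilon> / 5)"
    using drop_bad_strategies[OF xy(2) uy k small] by blast
  have dist: "(\<Sum>i<m. \<bar>x $ i - x' $ i\<bar>) \<le> 2 * \<epsilon> / 45" "(\<Sum>i<m. \<bar>y $ i - y' $ i\<bar>) \<le> 2 * \<epsilon> / 45"
    using x'(3) y'(3) bound by linarith+
  have "well_supported m R (\<epsilon> / 5) x' y" "well_supported m C\<^sup>T (\<epsilon> / 5) y' x"
    using x'(2) y'(2) by (auto simp: well_supported_def)
  \<comment> \<open>Each strategy was pruned against the original opponent; the last term pays for
    replacing that opponent by the pruned one.\<close>
  then have "well_supported m R (\<epsilon> / 5 + 4 * (2 * \<epsilon> / 45)) x' y'"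
    "well_supported m C\<^sup>T (\<epsilon> / 5 + 4 * (2 * \<epsilon> / 45)) y' x'"
    using R C by (auto intro!: well_supported_perturb[OF _ _ _ _ dist(1)] well_supported_perturb[OF _ _ _ _ dist(2)]
        simplexD(1)[OF xy(1)] simplexD(1)[OF xy(2)] simplexD(1)[OF x'(1)] simplexD(1)[OF y'(1)] simp del: times_divide_eq_right)
  then have "well_supported m R (\<epsilon> / 2) x' y'" "well_supported m C\<^sup>T (\<epsilon> / 2) y' x'"
    using \<epsilon>(1) by (auto elim!: well_supported_mono)
  then show ?thesis
    using that dist x'(1) y'(1) R(1) C(1) by (simp add: eps_WNE_iff)
qed

section \<open>Equilibria of the combined game\<close>

lemma sum_lessThan_add:
  fixes g :: "nat \<Rightarrow> 'a::comm_monoid_add"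
  shows "(\<Sum>i<N + K. g i) = (\<Sum>i<N. g i) + (\<Sum>i<K. g (N + i))"
  by (induction K) (simp_all add: add.assoc)

lemma combined_row_mult:
  assumes A: "A \<in> carrier_mat N N" and D: "D \<in> carrier_mat K K" and y: "y \<in> carrier_vec (N + K)"
  shows "i < N \<Longrightarrow> (combined_row N K \<delta> A D *\<^sub>v y) $ i =
      (\<Sum>j<N. A $$ (i, j) * y $ j) - 2 * (\<Sum>j<K. y $ (N + j))"
    and "i < K \<Longrightarrow> (combined_row N K \<delta> A D *\<^sub>v y) $ (N + i) =
      \<delta> * (\<Sum>j<N. y $ j) + (\<Sum>j<K. D $$ (i, j) * y $ (N + j))"
  using assms
  by (simp_all add: mult_mat_vec_sum[of _ "N + K" "N + K"] combined_row_def sum_lessThan_add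
      ones_mat_def sum_distrib_left sum_negf)

lemma combined_row_carrier:
  "A \<in> carrier_mat N N \<Longrightarrow> D \<in> carrier_mat K K \<Longrightarrow> combined_row N K \<delta> A D \<in> carrier_mat (N + K) (N + K)"
  by (simp add: combined_row_def)

lemma combined_col_carrier:
  "A \<in> carrier_mat N N \<Longrightarrow> D \<in> carrier_mat K K \<Longrightarrow> combined_col N K \<delta> A D \<in> carrier_mat (N + K) (N + K)"
  by (simp add: combined_col_def)

text \<open>Reduces the column player to the row player: transposition exchanges the off-diagonal
  blocks, so \<delta> and -2 land where \<open>combined_row\<close> has them.\<close>

lemma combined_col_transpose:
  "A \<in> carrier_mat N N \<Longrightarrow> D \<in> carrier_mat K K \<Longrightarrow>
    (combined_col N K \<delta> A D)\<^sup>T = combined_row N K \<delta> A\<^sup>T D\<^sup>T"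
  unfolding combined_col_def combined_row_def ones_mat_def
  by (subst transpose_four_block_mat[of _ N N _ K _ K]) (auto intro!: cong_four_block_mat)

text \<open>A strategy of the first block earns at most \<open>b - 2 (1 - b)\<close> against an opponent of mass \<open>b\<close> there,
  while the second block guarantees \<open>\<delta> b + (1 - b) / 2\<close>; so \<open>b\<close> must be large.\<close>

lemma first_block_played:
  assumes A: "A \<in> carrier_mat N N" "\<forall>i<N. \<forall>j<N. A $$ (i, j) \<le> 1"
    and D: "D \<in> carrier_mat K K" "\<forall>y\<in>simplex K. \<exists>i<K. (D *\<^sub>v y) $ i \<ge> 1 / 2"
    and "0 \<le> \<delta>" "\<eta> \<le> 1 / 2" "K > 0"
    and y: "y \<in> simplex (N + K)"
    and ws: "well_supported (N + K) (combined_row N K \<delta> A D) \<eta> x y"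
    and i: "i < N" "x $ i > 0"
  shows "4 / 7 \<le> (\<Sum>j<N. y $ j)"
    and "\<delta> * (\<Sum>j<N. y $ j) - \<eta> \<le> (\<Sum>j<N. A $$ (i, j) * y $ j)"
    and "k < N \<Longrightarrow> (\<Sum>j<N. A $$ (k, j) * y $ j) \<le> (\<Sum>j<N. A $$ (i, j) * y $ j) + \<eta>"
proof -
  let ?b = "\<Sum>j<N. y $ j" and ?c = "\<Sum>j<K. y $ (N + j)"
  note yD = simplexD[OF y]
  have bc: "?b + ?c = 1"
    using yD(3) by (simp add: sum_lessThan_add)
  have "?b \<ge> 0" "?c \<ge> 0"
    using yD(2) by (auto intro!: sum_nonneg)
  \<comment> \<open>The guarantee of 1/2 holds for probability vectors, so the tail of
    \<open>y\<close> is normalized and the bound scaled back by its mass \<open>?c\<close>. A tail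
    of mass zero cannot be normalized, but there row 0 gives 0 on both sides.\<close>
  have "\<exists>k<K. (\<Sum>j<K. D $$ (k, j) * y $ (N + j)) \<ge> ?c / 2"
  proof (cases "?c = 0")
    case True
    then have "\<forall>j<K. y $ (N + j) = 0"
      using sum_nonneg_eq_0_iff[of "{..<K}" "\<lambda>j. y $ (N + j)"] yD(2) by auto
    then have "(\<Sum>j<K. D $$ (0, j) * y $ (N + j)) = 0"
      by simp
    with True \<open>K > 0\<close> show ?thesis by (metis div_0 order_refl)
  next
    case False
    define z where "z = vec K (\<lambda>j. y $ (N + j) / ?c)"
    have "z \<in> simplex K"
      by (rule simplexI) (use False \<open>?c \<ge> 0\<close> yD(2) in \<open>auto simp: z_def simp flip: sum_divide_distrib\<close>)
    from D(2) this obtain k where k: "k < K" "(D *\<^sub>v z) $ k \<ge> 1 / 2" by blast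
    have "(D *\<^sub>v z) $ k = (\<Sum>j<K. D $$ (k, j) * y $ (N + j)) / ?c"
      using mult_mat_vec_sum[OF D(1), of z k] k(1) by (simp add: z_def sum_divide_distrib)
    with k False \<open>?c \<ge> 0\<close> show ?thesis
      by (auto simp: field_simps intro!: exI[of _ k])
  qed
  then obtain k' where k': "k' < K" "(\<Sum>j<K. D $$ (k', j) * y $ (N + j)) \<ge> ?c / 2" by blast
  let ?R = "combined_row N K \<delta> A D"
  have ws_i: "(?R *\<^sub>v y) $ l \<le> (?R *\<^sub>v y) $ i + \<eta>" if "l < N + K" for l
    using ws i that by (simp add: well_supported_def)
  note mult = combined_row_mult[OF A(1) D(1) yD(1), where \<delta> = \<delta>]
  have main: "\<delta> * ?b + ?c / 2 \<le> (\<Sum>j<N. A $$ (i, j) * y $ j) - 2 * ?c + \<eta>"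
    using ws_i[of "N + k'"] k' mult(1)[OF i(1)] mult(2)[of k'] by simp
  then show "\<delta> * ?b - \<eta> \<le> (\<Sum>j<N. A $$ (i, j) * y $ j)"
    using \<open>?c \<ge> 0\<close> by simp
  have "(\<Sum>j<N. A $$ (i, j) * y $ j) \<le> (\<Sum>j<N. 1 * y $ j)"
    by (intro sum_mono mult_right_mono) (use A(2) i yD(2) in auto)
  moreover have "\<delta> * ?b \<ge> 0" using \<open>?b \<ge> 0\<close> \<open>0 \<le> \<delta>\<close> by simp
  ultimately have "?c / 2 \<le> ?b - 2 * ?c + \<eta>"
    using main by simp
  \<comment> \<open>Inserting c = 1 - b and \<eta> \<le> 1/2 leaves 2 \<le> (7/2) b.\<close>
  then show "4 / 7 \<le> ?b"
    using bc \<open>\<eta> \<le> 1 / 2\<close> by linarith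
  show "(\<Sum>j<N. A $$ (k, j) * y $ j) \<le> (\<Sum>j<N. A $$ (i, j) * y $ j) + \<eta>" if "k < N"
    using ws_i[of k] mult(1)[OF i(1)] mult(1)[OF that] that by simp
qed

lemma sum_pos_imp_pos_term:
  assumes "0 < (\<Sum>i<N. g i :: real)" obtains i where "i < N" "0 < g i"
  using assms by (meson lessThan_iff not_le sum_nonpos)

lemma normalized_in_simplex:
  assumes "\<And>i. i < n \<Longrightarrow> 0 \<le> g i" "0 < (\<Sum>i<n. g i)"
  shows "vec n (\<lambda>i. g i / (\<Sum>i<n. g i)) \<in> simplex n"
  by (rule simplexI) (use assms in \<open>auto simp flip: sum_divide_distrib\<close>)

text \<open>The penalty caused by the opponent's second block is the same for all rows of the first
  block and cancels when they are compared. Dividing by the opponent's mass, which exceeds 1/2, at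
  most doubles the slack. Every row in the support then earns at least \<delta> - \<epsilon>, hence
  so does the mixture. Of \<open>x\<close> only the support matters for this, and scaling by any
  positive \<open>a\<close> preserves it.\<close>

lemma normalized_first_block:
  assumes A: "A \<in> carrier_mat N N" "\<forall>i<N. \<forall>j<N. A $$ (i, j) \<le> 1"
    and D: "D \<in> carrier_mat K K" "\<forall>y\<in>simplex K. \<exists>i<K. (D *\<^sub>v y) $ i \<ge> 1 / 2"
    and "0 \<le> \<delta>" "0 \<le> \<epsilon>" "\<epsilon> \<le> 1" "K > 0"
    and y: "y \<in> simplex (N + K)"
    and ws: "well_supported (N + K) (combined_row N K \<delta> A D) (\<epsilon> / 2) x y"
    and a: "a > 0" and x': "x' = vec N (\<lambda>i. x $ i / a)" "x' \<in> simplex N"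
    and y': "y' = vec N (\<lambda>i. y $ i / (\<Sum>j<N. y $ j))"
  shows "well_supported N A \<epsilon> x' y'" "\<delta> - \<epsilon> \<le> payoff x' A y'"
proof -
  let ?b = "\<Sum>j<N. y $ j"
  have val: "(A *\<^sub>v y') $ k = (\<Sum>j<N. A $$ (k, j) * y $ j) / ?b" if "k < N" for k
    using mult_mat_vec_sum[OF A(1), of y' k] that by (simp add: y' sum_divide_distrib)
  have best: "\<delta> - \<epsilon> \<le> (A *\<^sub>v y') $ i \<and> (\<forall>k<N. (A *\<^sub>v y') $ k \<le> (A *\<^sub>v y') $ i + \<epsilon>)"
    if "i < N" "x' $ i > 0" for i
  proof -
    have "x $ i > 0" using that a by (simp add: x' zero_less_divide_iff)
    have "\<epsilon> / 2 \<le> 1 / 2" using \<open>\<epsilon> \<le> 1\<close> by simp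
    note played = first_block_played[OF A D \<open>0 \<le> \<delta>\<close> this \<open>K > 0\<close> y ws \<open>i < N\<close> \<open>x $ i > 0\<close>]
    have b: "4 / 7 \<le> ?b" by (rule played(1))
    have half: "\<epsilon> / 2 \<le> \<epsilon> * ?b"
      using mult_left_mono[of "1 / 2" ?b \<epsilon>] b \<open>0 \<le> \<epsilon>\<close> by simp
    have "(\<delta> - \<epsilon>) * ?b \<le> (\<Sum>j<N. A $$ (i, j) * y $ j)"
      using played(2) half by (simp add: left_diff_distrib)
    moreover have "(\<Sum>j<N. A $$ (k, j) * y $ j) \<le> (\<Sum>j<N. A $$ (i, j) * y $ j) + \<epsilon> * ?b" if "k < N" for k
      using played(3)[OF that] half by simp
    moreover have "?b > 0" using b by simp
    ultimately have "\<delta> - \<epsilon> \<le> (\<Sum>j<N. A $$ (i, j) * y $ j) / ?b"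
      and "k < N \<Longrightarrow> (\<Sum>j<N. A $$ (k, j) * y $ j) / ?b \<le> ((\<Sum>j<N. A $$ (i, j) * y $ j) + \<epsilon> * ?b) / ?b" for k
      by (simp add: pos_le_divide_eq, intro divide_right_mono) simp_all
    with \<open>?b > 0\<close> show ?thesis
      using val \<open>i < N\<close> by (simp add: add_divide_distrib)
  qed
  then show "well_supported N A \<epsilon> x' y'"
    by (simp add: well_supported_def)
  have "(\<delta> - \<epsilon>) = (\<Sum>i<N. x' $ i * (\<delta> - \<epsilon>))"
    using simplexD(3)[OF x'(2)] by (simp flip: sum_distrib_right)
  also have "\<dots> \<le> (\<Sum>i<N. x' $ i * (A *\<^sub>v y') $ i)"
  proof (rule sum_mono)
    fix i assume "i \<in> {..<N}"
    then show "x' $ i * (\<delta> - \<epsilon>) \<le> x' $ i * (A *\<^sub>v y') $ i"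
      using best[of i] simplexD(2)[OF x'(2), of i] by (cases "x' $ i = 0") (auto intro: mult_left_mono)
  qed
  finally show "\<delta> - \<epsilon> \<le> payoff x' A y'"
    using payoff_sum[OF A(1) simplexD(1)[OF x'(2)]] by simp
qed

text \<open>If the opponent avoids the first block, the \<delta> contribution vanishes and row
  \<open>N + i\<close> earns exactly what row \<open>i\<close> of \<open>D\<close> earns, so the
  slack carries over unchanged.\<close>

lemma second_block_well_supported:
  assumes A: "A \<in> carrier_mat N N" and D: "D \<in> carrier_mat K K" and y: "y \<in> simplex (N + K)"
    and zero: "\<And>i. i < N \<Longrightarrow> y $ i = 0"
    and ws: "well_supported (N + K) (combined_row N K \<delta> A D) \<epsilon> x y"
  shows "well_supported K D \<epsilon> (vec K (\<lambda>i. x $ (N + i))) (vec K (\<lambda>i. y $ (N + i)))"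
proof -
  have "(combined_row N K \<delta> A D *\<^sub>v y) $ (N + i) = (D *\<^sub>v vec K (\<lambda>i. y $ (N + i))) $ i" if "i < K" for i
    using that combined_row_mult(2)[OF A D simplexD(1)[OF y] that] zero
      mult_mat_vec_sum[OF D, of "vec K (\<lambda>i. y $ (N + i))" i] by simp
  then show ?thesis
    using ws unfolding well_supported_def by (metis add_less_cancel_left index_vec)
qed

lemma combined_eps_WNE:
  assumes hard: "sos_hard t N \<epsilon> \<delta> R C" and enum: "enumeration_hard K \<epsilon> \<tau> c S RS CS"
    and "K > 0" "0 < \<epsilon>"
    and wne: "eps_WNE (N + K) (combined_row N K \<delta> R RS) (combined_col N K \<delta> C CS) (\<epsilon> / 2) x y"
  shows "eps_WNE K RS CS \<epsilon> (vec K (\<lambda>i. x $ (N + i))) (vec K (\<lambda>i. y $ (N + i)))"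
proof -
  have R: "R \<in> carrier_mat N N" "\<forall>i<N. \<forall>j<N. R $$ (i, j) \<le> 1"
    and C: "C \<in> carrier_mat N N" "C\<^sup>T \<in> carrier_mat N N"
      "\<forall>i<N. \<forall>j<N. C\<^sup>T $$ (i, j) \<le> 1"
    and \<epsilon>\<delta>: "\<epsilon> \<le> 1" "0 \<le> \<delta>"
    using hard by (auto simp: sos_hard_def unit_game_def)
  have RS: "RS \<in> carrier_mat K K" and CS: "CS \<in> carrier_mat K K" "CS\<^sup>T \<in> carrier_mat K K"
    using enum by (auto simp: enumeration_hard_def unit_game_def)
  have "\<forall>y\<in>simplex K. \<exists>i<K. payoff (unit_vec K i) RS y \<ge> 1 / 2"
    "\<forall>x\<in>simplex K. \<exists>j<K. payoff x CS (unit_vec K j) \<ge> 1 / 2"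
    using enum by (simp_all add: enumeration_hard_def)
  then have RS2: "\<forall>y\<in>simplex K. \<exists>i<K. (RS *\<^sub>v y) $ i \<ge> 1 / 2"
    and CS2: "\<forall>y\<in>simplex K. \<exists>i<K. (CS\<^sup>T *\<^sub>v y) $ i \<ge> 1 / 2"
    by (metis payoff_unit_left[OF RS], metis payoff_unit_right[OF CS(1)] simplexD(1))
  have x: "x \<in> simplex (N + K)" and y: "y \<in> simplex (N + K)"
    and wsx: "well_supported (N + K) (combined_row N K \<delta> R RS) (\<epsilon> / 2) x y"
    and wsy: "well_supported (N + K) (combined_row N K \<delta> C\<^sup>T CS\<^sup>T) (\<epsilon> / 2) y x"
    using wne R C RS CS
    by (simp_all add: eps_WNE_iff combined_row_carrier combined_col_carrier combined_col_transpose)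
  let ?a = "\<Sum>i<N. x $ i" and ?b = "\<Sum>i<N. y $ i"
  note xD = simplexD[OF x] and yD = simplexD[OF y]
  have half: "\<epsilon> / 2 \<le> 1 / 2" using \<epsilon>\<delta>(1) by simp
  \<comment> \<open>A player touching the first block forces the opponent to have mass there, and
    conversely. So the two first-block masses are both positive or both zero, and excluding the
    former empties the block for both players.\<close>
  have b_pos: "?b > 0" if "i < N" "x $ i > 0" for i
    using first_block_played(1)[OF R RS RS2 \<epsilon>\<delta>(2) half \<open>K > 0\<close> y wsx that] by linarith
  have a_pos: "?a > 0" if "i < N" "y $ i > 0" for i
    using first_block_played(1)[OF C(2,3) CS(2) CS2 \<epsilon>\<delta>(2) half \<open>K > 0\<close> x wsy that] by linarith
  have "\<not> (?a > 0 \<and> ?b > 0)"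
  proof
    assume pos: "?a > 0 \<and> ?b > 0"
    define x' y' where "x' = vec N (\<lambda>i. x $ i / ?a)" and "y' = vec N (\<lambda>i. y $ i / ?b)"
    have x': "x' \<in> simplex N" and y': "y' \<in> simplex N"
      unfolding x'_def y'_def using pos xD(2) yD(2) by (auto intro!: normalized_in_simplex)
    have eq: "payoff x' (R + C) y' = payoff x' R y' + payoff y' C\<^sup>T x'"
      using R(1) C(1) simplexD(1)[OF x'] simplexD(1)[OF y'] payoff_transpose[of C N N x' y']
      by (simp add: payoff_def add_mult_distrib_mat_vec[of _ N N] scalar_prod_add_distrib[of _ N])
    have "0 \<le> \<epsilon>" using \<open>0 < \<epsilon>\<close> by simp
    note nx = normalized_first_block[OF R RS RS2 \<epsilon>\<delta>(2) this \<epsilon>\<delta>(1) \<open>K > 0\<close> y wsx _ x'_def x' y'_def]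
    note ny = normalized_first_block[OF C(2,3) CS(2) CS2 \<epsilon>\<delta>(2) \<open>0 \<le> \<epsilon>\<close> \<epsilon>\<delta>(1) \<open>K > 0\<close> x wsy _ y'_def y' x'_def]
    have "eps_WNE N R C \<epsilon> x' y'"
      using nx(1) ny(1) x' y' pos R(1) C(1) by (simp add: eps_WNE_iff)
    then have "payoff x' (R + C) y' < 2 * (\<delta> - \<epsilon>)"
      using hard by (simp add: sos_hard_def)
    with nx(2) ny(2) pos show False by (simp add: eq)
  qed
  then have none: "\<not> ?a > 0" "\<not> ?b > 0"
    using a_pos b_pos by (meson sum_pos_imp_pos_term)+
  have x0: "x $ i = 0" and y0: "y $ i = 0" if "i < N" for i
    using a_pos[OF that] b_pos[OF that] none xD(2)[of i] yD(2)[of i] that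
    by (auto simp: order.order_iff_strict)
  have "vec K (\<lambda>i. x $ (N + i)) \<in> simplex K" "vec K (\<lambda>i. y $ (N + i)) \<in> simplex K"
    using xD(2,3) yD(2,3) x0 y0 by (auto simp: sum_lessThan_add intro!: simplexI)
  moreover have "well_supported K RS \<epsilon> (vec K (\<lambda>i. x $ (N + i))) (vec K (\<lambda>i. y $ (N + i)))"
    "well_supported K CS\<^sup>T \<epsilon> (vec K (\<lambda>i. y $ (N + i))) (vec K (\<lambda>i. x $ (N + i)))"
    using second_block_well_supported[OF R(1) RS y y0 wsx]
      second_block_well_supported[OF C(2) CS(2) x x0 wsy] \<open>0 < \<epsilon>\<close>
    by (auto elim!: well_supported_mono)
  ultimately show ?thesis
    using RS CS by (simp add: eps_WNE_iff)
qed

text \<open>Triangle inequality: \<tau> \<epsilon> comes from enumeration hardness at a nearby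
  well-supported equilibrium, 2 \<epsilon> / 45 from the distance to it. Either player's strategy
  alone thus pins down c times the uniform vector on \<open>S\<close>.\<close>

lemma combined_eps_NE_near_uniform:
  assumes hard: "sos_hard t N \<epsilon> \<delta> R C" and enum: "enumeration_hard K \<epsilon> \<tau> c S RS CS"
    and "K > 0" "0 < \<epsilon>" "\<epsilon>' \<le> (\<epsilon> / 15)\<^sup>2"
    and ne: "eps_NE (N + K) (combined_row N K \<delta> R RS) (combined_col N K \<delta> C CS) \<epsilon>' x y"
    and n: "n = nat \<lfloor>c * real K\<rfloor>"
  shows "(\<Sum>k<n. \<bar>x $ (N + k) - c * unif_vec n S $ k\<bar>) \<le> \<tau> * \<epsilon> + 2 * \<epsilon> / 45"
    and "(\<Sum>k<n. \<bar>y $ (N + k) - c * unif_vec n S $ k\<bar>) \<le> \<tau> * \<epsilon> + 2 * \<epsilon> / 45"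
proof -
  have games: "unit_game N R C" "unit_game K RS CS" and "0 \<le> \<delta>" "\<delta> \<le> 1" "\<epsilon> \<le> 1" "c \<le> 1"
    using hard enum by (auto simp: sos_hard_def enumeration_hard_def)
  then have mats: "R \<in> carrier_mat N N" "C \<in> carrier_mat N N" "RS \<in> carrier_mat K K" "CS \<in> carrier_mat K K"
    by (auto simp: unit_game_def)
  \<comment> \<open>The value 2 is attained by the off-diagonal blocks of entries -2; all other
    entries have absolute value at most 1.\<close>
  have bounded: "\<bar>M $$ (i, j)\<bar> \<le> 2" if "i < N + K" "j < N + K"
    "M \<in> {combined_row N K \<delta> R RS, combined_col N K \<delta> C CS}" for M i j
  proof -
    have "\<bar>R $$ (i, j)\<bar> \<le> 2" "\<bar>C $$ (i, j)\<bar> \<le> 2" if "i < N" "j < N" for i j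
      using games that by (fastforce simp: unit_game_def abs_le_iff)+
    moreover have "\<bar>RS $$ (i, j)\<bar> \<le> 2" "\<bar>CS $$ (i, j)\<bar> \<le> 2" if "i < K" "j < K" for i j
      using games that by (fastforce simp: unit_game_def abs_le_iff)+
    ultimately show ?thesis
      using that mats \<open>0 \<le> \<delta>\<close> \<open>\<delta> \<le> 1\<close>
      by (auto simp: combined_row_def combined_col_def ones_mat_def)
  qed
  obtain x' y' where wne: "eps_WNE (N + K) (combined_row N K \<delta> R RS) (combined_col N K \<delta> C CS) (\<epsilon> / 2) x' y'"
    and dist: "(\<Sum>i<N + K. \<bar>x $ i - x' $ i\<bar>) \<le> 2 * \<epsilon> / 45" "(\<Sum>i<N + K. \<bar>y $ i - y' $ i\<bar>) \<le> 2 * \<epsilon> / 45"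
    by (rule eps_NE_near_eps_WNE[OF _ _ _ _ \<open>0 < \<epsilon>\<close> \<open>\<epsilon> \<le> 1\<close> assms(5) ne])
      (use mats bounded in \<open>auto simp: combined_row_carrier combined_col_carrier\<close>)
  have "c * real K \<le> 1 * real K" using \<open>c \<le> 1\<close> by (intro mult_right_mono) auto
  then have "n \<le> K" unfolding n by linarith
  have key: "(\<Sum>k<n. \<bar>u $ (N + k) - c * unif_vec n S $ k\<bar>) \<le> \<tau> * \<epsilon> + 2 * \<epsilon> / 45"
    if d: "(\<Sum>i<N + K. \<bar>u $ i - u' $ i\<bar>) \<le> 2 * \<epsilon> / 45"
      and l: "l1_norm (vec_first (vec K (\<lambda>i. u' $ (N + i))) n - c \<cdot>\<^sub>v unif_vec n S) \<le> \<tau> * \<epsilon>" for u u'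
  proof -
    have "(\<Sum>k<n. \<bar>u $ (N + k) - c * unif_vec n S $ k\<bar>) \<le>
        (\<Sum>k<n. \<bar>u $ (N + k) - u' $ (N + k)\<bar> + \<bar>u' $ (N + k) - c * unif_vec n S $ k\<bar>)"
      by (rule sum_mono) simp
    also have "\<dots> = (\<Sum>k<n. \<bar>u $ (N + k) - u' $ (N + k)\<bar>) + (\<Sum>k<n. \<bar>u' $ (N + k) - c * unif_vec n S $ k\<bar>)"
      by (rule sum.distrib)
    also have "(\<Sum>k<n. \<bar>u' $ (N + k) - c * unif_vec n S $ k\<bar>) \<le> \<tau> * \<epsilon>"
      using l \<open>n \<le> K\<close> by (simp add: l1_norm_def unif_vec_def vec_first_def)
    also have "(\<Sum>k<n. \<bar>u $ (N + k) - u' $ (N + k)\<bar>) \<le> (\<Sum>k<K. \<bar>u $ (N + k) - u' $ (N + k)\<bar>)"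
      using \<open>n \<le> K\<close> by (intro sum_mono2) auto
    also have "\<dots> \<le> (\<Sum>i<N + K. \<bar>u $ i - u' $ i\<bar>)"
      by (simp add: sum_lessThan_add sum_nonneg)
    finally show ?thesis using d by simp
  qed
  have "l1_norm (vec_first (vec K (\<lambda>i. x' $ (N + i))) n - c \<cdot>\<^sub>v unif_vec n S) \<le> \<tau> * \<epsilon>"
    "l1_norm (vec_first (vec K (\<lambda>i. y' $ (N + i))) n - c \<cdot>\<^sub>v unif_vec n S) \<le> \<tau> * \<epsilon>"
    using enum combined_eps_WNE[OF hard enum \<open>K > 0\<close> \<open>0 < \<epsilon>\<close> wne]
    by (auto simp: enumeration_hard_def Let_def n)
  then show "(\<Sum>k<n. \<bar>x $ (N + k) - c * unif_vec n S $ k\<bar>) \<le> \<tau> * \<epsilon> + 2 * \<epsilon> / 45"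
    "(\<Sum>k<n. \<bar>y $ (N + k) - c * unif_vec n S $ k\<bar>) \<le> \<tau> * \<epsilon> + 2 * \<epsilon> / 45"
    using key dist by blast+
qed

section \<open>Recovering the set from a strategy\<close>

lemma l1_norm_unif_vec_diff:
  assumes "n \<le> K" "S \<subseteq> {..<n}" "T \<subseteq> {..<n}"
  shows "l1_norm (unif_vec K S - unif_vec K T) = (\<Sum>k<n. \<bar>unif_vec n S $ k - unif_vec n T $ k\<bar>)"
proof -
  have "l1_norm (unif_vec K S - unif_vec K T) = (\<Sum>k<K. \<bar>unif_vec K S $ k - unif_vec K T $ k\<bar>)"
    by (simp add: l1_norm_def unif_vec_def)
  also have "\<dots> = (\<Sum>k<n. \<bar>unif_vec K S $ k - unif_vec K T $ k\<bar>)"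
    by (rule sum.mono_neutral_right) (use assms in \<open>auto simp: unif_vec_def\<close>)
  also have "\<dots> = (\<Sum>k<n. \<bar>unif_vec n S $ k - unif_vec n T $ k\<bar>)"
    by (rule sum.cong) (use assms(1) in \<open>auto simp: unif_vec_def\<close>)
  finally show ?thesis .
qed

text \<open>Triangle inequality through the common point \<open>z\<close>. The weight 1 /
  \<open>card S\<close> does not depend on the length of the vector, so for sets below n the
  distance is the same in dimension n and in dimension K.\<close>

lemma unif_vec_separation:
  fixes z :: "nat \<Rightarrow> real"
  assumes "n \<le> K" "S \<subseteq> {..<n}" "T \<subseteq> {..<n}" "c > 0"
    and "(\<Sum>k<n. \<bar>z k - c * unif_vec n S $ k\<bar>) \<le> r" "(\<Sum>k<n. \<bar>z k - c * unif_vec n T $ k\<bar>) \<le> r"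
  shows "c * l1_norm (unif_vec K S - unif_vec K T) \<le> 2 * r"
proof -
  have "c * l1_norm (unif_vec K S - unif_vec K T) =
      (\<Sum>k<n. \<bar>c * unif_vec n S $ k - c * unif_vec n T $ k\<bar>)"
    unfolding l1_norm_unif_vec_diff[OF assms(1-3)] sum_distrib_left
    using \<open>c > 0\<close> by (simp add: abs_mult flip: right_diff_distrib)
  also have "\<dots> \<le> (\<Sum>k<n. \<bar>z k - c * unif_vec n S $ k\<bar> + \<bar>z k - c * unif_vec n T $ k\<bar>)"
    by (rule sum_mono) simp
  also have "\<dots> \<le> 2 * r"
    using assms(5,6) by (simp add: sum.distrib)
  finally show ?thesis .
qed

text \<open>The assumption \<open>S_prefix\<close> ties the separation hypothesis to what equilibria
  reveal. Enumeration hardness describes only the first c K coordinates of the second block, whereas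
  the separation is measured on all K of them.\<close>

theorem mainTheorem8:
  fixes \<epsilon> \<delta> \<tau> c :: real and t N K f :: nat
    and R C :: "real mat"
    and S :: "nat \<Rightarrow> nat set" and RS CS :: "nat \<Rightarrow> real mat"
  assumes "0 < \<epsilon>" and "\<epsilon> < \<delta>" and "\<delta> \<le> 1 / 2" and "\<tau> > 0" and "0 < c" and "c \<le> 1"
    and "t > 0" and "N > 0" and "K > 0" and "c * real K \<in> \<int>"
    and h1: "sos_hard t N \<epsilon> \<delta> R C"
    and h2_sep: "\<And>i j. i < f \<Longrightarrow> j < f \<Longrightarrow> i \<noteq> j \<Longrightarrow>
      l1_norm (unif_vec K (S i) - unif_vec K (S j)) > 18 / c * (\<tau> + 1) * \<epsilon>"
    and h2_hard: "\<And>i. i < f \<Longrightarrow> enumeration_hard K \<epsilon> \<tau> c (S i) (RS i) (CS i)"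
    and S_prefix: "\<And>i. i < f \<Longrightarrow> S i \<subseteq> {..<nat \<lfloor>c * real K\<rfloor>}"
  shows "(\<exists>\<mu>. pseudo_distribution t (2 * (N + K)) \<mu> \<and>
            (\<forall>i<f. pseudo_equilibrium t (N + K)
               (combined_row N K \<delta> R (RS i)) (combined_col N K \<delta> C (CS i)) \<mu>)) \<and>
         (\<forall>\<epsilon>' i j. 0 \<le> \<epsilon>' \<longrightarrow> \<epsilon>' \<le> (\<epsilon> / 15)\<^sup>2 \<longrightarrow> i < f \<longrightarrow> j < f \<longrightarrow> i \<noteq> j \<longrightarrow>
            \<not> (\<exists>x y y'.
                 eps_NE (N + K) (combined_row N K \<delta> R (RS i)) (combined_col N K \<delta> C (CS i)) \<epsilon>' x y \<and>
                 eps_NE (N + K) (combined_row N K \<delta> R (RS j)) (combined_col N K \<delta> C (CS j)) \<epsilon>' x y') \<and>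
            \<not> (\<exists>y x x'.
                 eps_NE (N + K) (combined_row N K \<delta> R (RS i)) (combined_col N K \<delta> C (CS i)) \<epsilon>' x y \<and>
                 eps_NE (N + K) (combined_row N K \<delta> R (RS j)) (combined_col N K \<delta> C (CS j)) \<epsilon>' x' y))"
proof (intro conjI allI impI)
  obtain \<mu> where \<mu>: "pseudo_equilibrium t N R C \<mu>"
    "satisfies_nonneg t (2 * N) \<mu> (payoff_poly N R - PConst \<delta>)"
    "satisfies_nonneg t (2 * N) \<mu> (payoff_poly N C - PConst \<delta>)"
    using h1 by (auto simp: sos_hard_def)
  have "R \<in> carrier_mat N N" "C \<in> carrier_mat N N"
    using h1 by (auto simp: sos_hard_def unit_game_def)
  moreover have "RS i \<in> carrier_mat K K" "CS i \<in> carrier_mat K K" if "i < f" for i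
    using h2_hard[OF that] by (auto simp: enumeration_hard_def unit_game_def)
  moreover have "\<delta> > 0"
    using \<open>0 < \<epsilon>\<close> \<open>\<epsilon> < \<delta>\<close> by simp
  ultimately have "\<forall>i<f. pseudo_equilibrium t (N + K) (combined_row N K \<delta> R (RS i))
      (combined_col N K \<delta> C (CS i)) (push_measure (pad N K) \<mu>)"
    using pseudo_equilibrium_combined[OF \<mu>] \<open>N > 0\<close> by simp
  moreover have "pseudo_distribution t (2 * (N + K)) (push_measure (pad N K) \<mu>)"
    by (rule pad.pseudo_distribution_push) (use \<mu>(1) in \<open>simp add: pseudo_equilibrium_def\<close>)
  ultimately show "\<exists>\<mu>. pseudo_distribution t (2 * (N + K)) \<mu> \<and>
      (\<forall>i<f. pseudo_equilibrium t (N + K)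
        (combined_row N K \<delta> R (RS i)) (combined_col N K \<delta> C (CS i)) \<mu>)"
    by blast
next
  fix \<epsilon>' i j
  assume small: "\<epsilon>' \<le> (\<epsilon> / 15)\<^sup>2" and ij: "i < f" "j < f" "i \<noteq> j"
  let ?NE = "\<lambda>i. eps_NE (N + K) (combined_row N K \<delta> R (RS i)) (combined_col N K \<delta> C (CS i)) \<epsilon>'"
  define n where "n = nat \<lfloor>c * real K\<rfloor>"
  have "c * real K \<le> 1 * real K"
    using \<open>c \<le> 1\<close> by (intro mult_right_mono) auto
  then have "n \<le> K"
    unfolding n_def by linarith
  have no_common: False
    if "(\<Sum>k<n. \<bar>z $ (N + k) - c * unif_vec n (S i) $ k\<bar>) \<le> \<tau> * \<epsilon> + 2 * \<epsilon> / 45"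
      "(\<Sum>k<n. \<bar>z $ (N + k) - c * unif_vec n (S j) $ k\<bar>) \<le> \<tau> * \<epsilon> + 2 * \<epsilon> / 45" for z :: "real vec"
  proof -
    \<comment> \<open>A shared strategy would bound the scaled distance by 2 \<tau> \<epsilon> + 4
      \<epsilon> / 45, well below the assumed 18 (\<tau> + 1) \<epsilon>.\<close>
    have "c * l1_norm (unif_vec K (S i) - unif_vec K (S j)) \<le> 2 * (\<tau> * \<epsilon> + 2 * \<epsilon> / 45)"
      using unif_vec_separation[OF \<open>n \<le> K\<close> _ _ \<open>0 < c\<close> that] S_prefix ij by (simp add: n_def)
    moreover have "18 * (\<tau> + 1) * \<epsilon> < c * l1_norm (unif_vec K (S i) - unif_vec K (S j))"
      using mult_strict_left_mono[OF h2_sep[OF ij] \<open>0 < c\<close>] \<open>0 < c\<close> by simp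
    moreover have "0 < \<tau> * \<epsilon>"
      using \<open>\<tau> > 0\<close> \<open>0 < \<epsilon>\<close> by simp
    ultimately show False
      using \<open>0 < \<epsilon>\<close> by (simp add: distrib_right distrib_left)
  qed
  note near = combined_eps_NE_near_uniform[OF h1 h2_hard \<open>K > 0\<close> \<open>0 < \<epsilon>\<close> small _ n_def]
  show "\<not> (\<exists>x y y'. ?NE i x y \<and> ?NE j x y')"
    using near(1) no_common ij by blast
  show "\<not> (\<exists>y x x'. ?NE i x y \<and> ?NE j x' y)"
    using near(2) no_common ij by blast
qed

end
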